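(* Let $k=2$ and $n\geqslant 2$. (a) The maximum of $\operatorname{vol}([-1,1]^n\cap H_2)$ over all $2$-dimensional subspaces $H_2\subset\mathbb{R}^n$ is attained on subspaces $H_2$ such that $[-1,1]^n\cap H_2$ is an affine cube (a parallelogram), i.e. $\operatorname{vol}([-1,1]^n\cap H_2)\leqslant C_{\mathrm{cube}}(n,2)\,2^2$. (b) The minimum of $\operatorname{vol}(B_1^n\mid H_2)$ over all $2$-dimensional subspaces $H_2\subset\mathbb{R}^n$ is attained on subspaces $H_2$ such that $B_1^n\mid H_2$ is an affine cross-polytope, i.e. $\operatorname{vol}(B_1^n\mid H_2)\geqslant C_{\mathrm{cross}}(n,2)\,\frac{2^2}{2!}$.
   Context: $B_1^n=\{x\in\mathbb{R}^n\mid |x_1|+\cdots+|x_n|\leqslant 1\}$ is the standard cross-polytope and $[-1,1]^n$ the standard cube; $K\mid H$ denotes orthogonal projection onto $H$ and $\operatorname{vol}$ is the volume in the subspace. For a $k$-dimensional subspace, $C_{\mathrm{cube}}(n,k)\,2^k$ is defined as the maximum volume of a section $[-1,1]^n\cap H_k$ over those $k$-dimensional subspaces $H_k$ for which $[-1,1]^n\cap H_k$ is an affine cube, and $C_{\mathrm{cross}}(n,k)\,\frac{2^k}{k!}$ is defined as the minimum volume of a projection $B_1^n\mid H_k$ over those $H_k$ for which $B_1^n\mid H_k$ is an affine cross-polytope. *)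

theory Defs
  imports "HOL-Analysis.Analysis"
begin

definition std_cube :: "(real^'n) set" where
  "std_cube = {x. \<forall>i. \<bar>x $ i\<bar> \<le> 1}"

definition std_cross :: "(real^'n) set" where
  "std_cross = {x. (\<Sum>i\<in>UNIV. \<bar>x $ i\<bar>) \<le> 1}"

definition affine_copy :: "(real^'k) set \<Rightarrow> (real^'n) set \<Rightarrow> bool" where
  "affine_copy P S \<longleftrightarrow> (\<exists>a f. linear f \<and> inj f \<and> S = (\<lambda>x. a + f x) ` P)"

definition proj_onto :: "(real^'n) set \<Rightarrow> (real^'n) set \<Rightarrow> (real^'n) set" where
  "proj_onto H K = {y \<in> H. \<exists>x\<in>K. \<forall>h\<in>H. (x - y) \<bullet> h = 0}"

text \<open>Two-dimensional volume of a set A inside a 2-dimensional subspace H,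
  computed by pulling A back along a linear isometry from R^2 onto H.\<close>
definition vol2 :: "(real^'n) set \<Rightarrow> (real^'n) set \<Rightarrow> real" where
  "vol2 H A = measure lebesgue
     ((SOME f :: real^2 \<Rightarrow> real^'n. linear f \<and> (\<forall>x. norm (f x) = norm x) \<and> range f = H) -` A)"

end

theory Submission
  imports Defs
begin

text \<open>Parametrise the plane \<open>H\<close> isometrically; the coordinate functionals become vectors \<open>v\<^sub>1, \<dots>, v\<^sub>n\<close> in the
  plane with \<open>\<Sum> v\<^sub>i v\<^sub>i\<^sup>T = 1\<close>, hence \<open>\<Sum>\<^sub>i\<^sub><\<^sub>j det (v\<^sub>i, v\<^sub>j)\<^sup>2 = 1\<close>. The section is \<open>K = {x. \<forall>i. \<bar>v\<^sub>i \<bullet> x\<bar> \<le> 1}\<close> and the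
  projection is the convex hull \<open>P\<close> of the points \<open>\<plusminus>v\<^sub>i\<close>. Put \<open>\<alpha> = area K / 4\<close> or \<open>\<alpha> = 2 / area P\<close>. Comparing
  \<open>K\<close> and \<open>P\<close> with the parallelograms and hexagons belonging to two or three of the \<open>v\<^sub>i\<close> gives inequalities
  for the numbers \<open>w\<^sub>i\<^sub>j = \<alpha> \<bar>det (v\<^sub>i, v\<^sub>j)\<bar>\<close>. With the Pluecker relation these imply
  \<open>\<alpha>\<^sup>2 = \<Sum>\<^sub>i\<^sub><\<^sub>j w\<^sub>i\<^sub>j\<^sup>2 \<le> m\<close> where \<open>m\<close> is the product of \<open>n/2\<close> rounded down and \<open>n/2\<close> rounded up, as in
  Mantel's theorem on triangle-free graphs. So \<open>area K \<le> 4 sqrt m\<close> and \<open>area P \<ge> 2 / sqrt m\<close>. Both bounds are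
  attained when the coordinates are split into two halves and the \<open>v\<^sub>i\<close> in each half coincide, the two
  common vectors being orthogonal.\<close>

subsection \<open>Inequalities for a third vector in the plane\<close>

text \<open>Put \<open>\<sigma> = a + b - 1\<close>, so that
  \<open>a^2 + b^2 = (1 + \<sigma>)^2 - 2 a b\<close>. Up to \<open>\<sigma> = 4 c\<close> the lower
  bound \<open>a b >= \<sigma>\<close> suffices; beyond it \<open>cut\<close> takes over with
  \<open>a b >= \<sigma>^2 / (4 c)\<close>.\<close>

lemma corner_cut_norm_bound:
  fixes a b c :: real
  assumes "0 \<le> a" "a \<le> 1" "0 \<le> b" "b \<le> 1" "1 \<le> a + b" "0 \<le> c" "c \<le> 1/4"
    and cut: "(a + b - 1)\<^sup>2 \<le> 4 * a * b * c"
  shows "a\<^sup>2 + b\<^sup>2 \<le> 1 + 16 * c\<^sup>2"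
proof -
  define \<sigma> where "\<sigma> = a + b - 1"
  have P: "a * b \<ge> \<sigma>"
    using mult_nonneg_nonneg[of "1 - a" "1 - b"] assms by (simp add: \<sigma>_def algebra_simps)
  have sq: "a\<^sup>2 + b\<^sup>2 = (1 + \<sigma>)\<^sup>2 - 2 * (a * b)"
    by (simp add: \<sigma>_def power2_eq_square algebra_simps)
  have "\<sigma> \<ge> 0" using assms by (simp add: \<sigma>_def)
  show ?thesis
  proof (cases "\<sigma> \<le> 4 * c")
    case True
    then have "\<sigma>\<^sup>2 \<le> (4 * c)\<^sup>2"
      using \<open>\<sigma> \<ge> 0\<close> by (intro power_mono)
    with sq P show ?thesis by (simp add: power2_eq_square algebra_simps)
  next
    case False
    define \<tau> where "\<tau> = \<sigma> - 4 * c"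
    have \<tau>: "\<tau> > 0" "\<sigma> = 4 * c + \<tau>" using False by (auto simp: \<tau>_def)
    have "c > 0"
    proof (rule ccontr)
      assume "\<not> c > 0"
      with assms have "\<sigma>\<^sup>2 \<le> 0" by (simp add: \<sigma>_def)
      with False \<open>\<not> c > 0\<close> \<open>0 \<le> c\<close> show False by simp
    qed
    \<comment> \<open>After substituting \<open>\<sigma> = 4 c + \<tau>\<close>, the inequality to
      be reached has the factor \<open>\<tau>\<close>; the cofactor
      \<open>4 c + \<tau> - 2 c (8 c + \<tau>)\<close> is nonnegative since
      \<open>c <= 1/4\<close>.\<close>
    have "c * (4 * c) \<le> c * 1" "c * \<tau> \<le> 1/4 * \<tau>"
      using assms \<tau> by (intro mult_left_mono mult_right_mono; simp)+
    moreover have "2 * c * (8 * c + \<tau>) = 4 * (c * (4 * c)) + 2 * (c * \<tau>)"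
      by (simp add: algebra_simps)
    ultimately have "2 * c * (8 * c + \<tau>) \<le> 4 * c + \<tau>" using \<tau>(1) by linarith
    then have "\<tau> * (2 * c * (8 * c + \<tau>)) \<le> \<tau> * (4 * c + \<tau>)"
      using \<tau> by (intro mult_left_mono) auto
    then have "2 * c * (2 * \<sigma> + \<sigma>\<^sup>2 - 16 * c\<^sup>2) \<le> \<sigma>\<^sup>2"
      by (simp add: \<tau>(2) power2_eq_square algebra_simps)
    also have "\<dots> \<le> 2 * c * (2 * (a * b))" using cut by (simp add: \<sigma>_def algebra_simps)
    finally have "2 * \<sigma> + \<sigma>\<^sup>2 - 16 * c\<^sup>2 \<le> 2 * (a * b)" using \<open>c > 0\<close> by simp
    with sq show ?thesis by (simp add: power2_eq_square algebra_simps)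
  qed
qed

text \<open>The next lemmas concern vectors \<open>u\<close>, \<open>w\<close> with \<open>\<bar>det (u, w)\<bar> = r\<close> maximal and a third vector
  \<open>z = a u + b w\<close>; it is bad if \<open>det (u, z)\<^sup>2 + det (w, z)\<^sup>2 > 1\<close>. The numerical constants are chosen with
  \<open>837/1000\<close> slightly above the largest \<open>r\<close> that admits a bad vector, and \<open>37/100\<close> such that
  \<open>(837/1000)\<^sup>2 (2 + (37/100)\<^sup>2) \<le> 3/2\<close>.\<close>
lemma bad_corner_scale:
  fixes a b r :: real
  assumes ab: "0 \<le> a" "a \<le> 1" "0 \<le> b" "b \<le> 1" "1 \<le> a + b" and r: "0 \<le> r" "r \<le> 1"
    and cut: "(a + b - 1)\<^sup>2 \<le> 4 * a * b * (1 - r)"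
    and bad: "1 < r\<^sup>2 * (a\<^sup>2 + b\<^sup>2)"
  shows "r \<le> 837/1000"
proof (rule ccontr)
  assume nr: "\<not> ?thesis"
  define c where "c = 1 - r"
  have c: "0 \<le> c" "c \<le> 163/1000" "r = 1 - c" using nr r by (auto simp: c_def)
  have "a\<^sup>2 + b\<^sup>2 \<le> 1 + 16 * c\<^sup>2"
    using ab c cut by (intro corner_cut_norm_bound) auto
  then have "1 < r\<^sup>2 * (1 + 16 * c\<^sup>2)"
    using bad by (smt (verit) mult_left_mono zero_le_power2)
  then have "0 < c * (17 * c - 2 - 32 * c\<^sup>2 + 16 * c ^ 3)"
    by (simp add: c(3) power2_eq_square power3_eq_cube algebra_simps)
  moreover have "17 * c - 2 - 32 * c\<^sup>2 + 16 * c ^ 3 \<le> 0"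
  proof -
    have 1: "c\<^sup>2 * c \<le> c\<^sup>2 * (163/1000)" using c by (intro mult_left_mono) auto
    \<comment> \<open>Replaces \<open>c^2\<close> by its tangent at the endpoint
      \<open>163/1000\<close>; the resulting linear function increases and is just below 0
      there.\<close>
    have 2: "0 \<le> (c - 163/1000)\<^sup>2" by simp
    have 3: "c ^ 3 = c\<^sup>2 * c" by (simp add: power2_eq_square power3_eq_cube)
    have "17 * c - 2 - 32 * c\<^sup>2 + 16 * c ^ 3 \<le> 17 * c - 2 - (29392/1000) * c\<^sup>2"
      using 1 unfolding 3 by simp
    also have "\<dots> \<le> 17 * c - 2 - (29392/1000) * (2 * (163/1000) * c - (163/1000)\<^sup>2)"
      using 2 by (simp add: power2_eq_square algebra_simps)
    also have "\<dots> \<le> 0" using c by (simp add: power2_eq_square algebra_simps)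
    finally show ?thesis .
  qed
  ultimately show False using c by (smt (verit) mult_nonneg_nonpos)
qed

text \<open>The left side is \<open>r^2 + p^2 + q^2\<close> for \<open>a = p/r\<close>,
  \<open>b = q/r\<close>. Up to \<open>r = 3/4\<close> the trivial bound \<open>27/16\<close> is
  enough; above it \<open>c = 1 - r\<close> is at most \<open>1/4\<close>, as
  \<open>corner_cut_norm_bound\<close> requires.\<close>

lemma bad_corner_triple_sum:
  fixes a b r :: real
  assumes ab: "0 \<le> a" "a \<le> 1" "0 \<le> b" "b \<le> 1" "1 \<le> a + b" and r: "0 \<le> r" "r \<le> 1"
    and cut: "(a + b - 1)\<^sup>2 \<le> 4 * a * b * (1 - r)"
  shows "r\<^sup>2 * (1 + a\<^sup>2 + b\<^sup>2) \<le> 2"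
proof (cases "r \<le> 3/4")
  case True
  have "a\<^sup>2 \<le> 1" "b\<^sup>2 \<le> 1" using ab by (auto simp: power_le_one)
  moreover have "r\<^sup>2 \<le> (3/4)\<^sup>2" using True r by (intro power_mono)
  ultimately have "r\<^sup>2 * (1 + a\<^sup>2 + b\<^sup>2) \<le> (3/4)\<^sup>2 * 3" by (intro mult_mono) auto
  then show ?thesis by (simp add: power2_eq_square)
next
  case False
  define c where "c = 1 - r"
  have c: "0 \<le> c" "c \<le> 1/4" "r = 1 - c" using False r by (auto simp: c_def)
  have "a\<^sup>2 + b\<^sup>2 \<le> 1 + 16 * c\<^sup>2"
    using ab c cut by (intro corner_cut_norm_bound) auto
  then have "r\<^sup>2 * (1 + a\<^sup>2 + b\<^sup>2) \<le> (1 - c)\<^sup>2 * (2 + 16 * c\<^sup>2)"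
    unfolding c(3) by (intro mult_left_mono) auto
  also have "\<dots> = 2 + 2 * c * (9 * c - 2 - 16 * c\<^sup>2 + 8 * c ^ 3)"
    by (simp add: power2_eq_square power3_eq_cube algebra_simps)
  also have "\<dots> \<le> 2"
  proof -
    have 1: "c\<^sup>2 * c \<le> c\<^sup>2 * (1/4)" using c by (intro mult_left_mono) auto
    have 3: "c ^ 3 = c\<^sup>2 * c" by (simp add: power2_eq_square power3_eq_cube)
    \<comment> \<open>\<open>9/28\<close> is the vertex of \<open>9 c - 2 - 14 c^2\<close>, whose
      maximum \<open>81/56 - 2\<close> is negative.\<close>
    have 2: "0 \<le> (c - 9/28)\<^sup>2" by simp
    have "9 * c - 2 - 16 * c\<^sup>2 + 8 * c ^ 3 \<le> 9 * c - 2 - 14 * c\<^sup>2" using 1 unfolding 3 by linarith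
    also have "\<dots> \<le> 0" using 2 by (simp add: power2_eq_square algebra_simps)
    finally show ?thesis using c by (simp add: mult_nonneg_nonpos)
  qed
  finally show ?thesis .
qed

text \<open>A bad vector with this \<open>r\<close> has \<open>a^2 + b^2 > 14/10\<close>, whereas
  below the line \<open>b = 1 - 37/100 a\<close> the unit square stays within
  \<open>14/10\<close>.\<close>

lemma bad_corner_near_axis:
  fixes a b r :: real
  assumes ab: "0 \<le> a" "a \<le> 1" "0 \<le> b" and r: "0 \<le> r" "r \<le> 837/1000"
    and bad: "1 < r\<^sup>2 * (a\<^sup>2 + b\<^sup>2)"
  shows "1 - b \<le> 37/100 * a"
proof (rule ccontr)
  assume "\<not> ?thesis"
  then have b: "b \<le> 1 - 37/100 * a" by simp
  have "b\<^sup>2 \<le> (1 - 37/100 * a)\<^sup>2" using b ab by (intro power_mono)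
  moreover have "a * a \<le> a" using ab by (simp add: mult_left_le)
  ultimately have "a\<^sup>2 + b\<^sup>2 \<le> 14/10" using ab by (simp add: power2_eq_square algebra_simps)
  moreover have "r\<^sup>2 \<le> (837/1000)\<^sup>2" using r by (intro power_mono) auto
  ultimately have "r\<^sup>2 * (a\<^sup>2 + b\<^sup>2) \<le> (837/1000)\<^sup>2 * (14/10)" by (intro mult_mono) auto
  with bad show False by (simp add: power2_eq_square)
qed

lemma quadratic_le_max_endpoints:
  fixes A B C t :: real
  assumes "0 \<le> A" "0 \<le> t" "t \<le> 1" "C \<le> M" "A + B + C \<le> M"
  shows "A * t\<^sup>2 + B * t + C \<le> M"
proof -
  have "t * (A + B + C) \<le> t * M" "(1 - t) * C \<le> (1 - t) * M" "A * (t * t) \<le> A * t"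
    using assms by (auto intro!: mult_left_mono simp: mult_left_le)
  then show ?thesis by (simp add: power2_eq_square algebra_simps)
qed

text \<open>Up to sign, \<open>s\<close>, \<open>t\<close> and \<open>b s - a t\<close> are the
  determinants, divided by \<open>r\<close>, of a fourth vector with \<open>w\<close>,
  \<open>u\<close>, \<open>z\<close>. The sum is convex in each of \<open>s\<close> and
  \<open>t\<close>, so the corners decide; the worst one, \<open>s = t = 1\<close>, gives
  \<open>2 + (b - a)^2\<close>.\<close>

lemma same_side_bound:
  fixes a b s t :: real
  assumes ab: "0 \<le> a" "a \<le> 1" "0 \<le> b" "b \<le> 1" "1 - b \<le> 37/100 * a" "1 - a \<le> 37/100 * b"
    and st: "0 \<le> s" "s \<le> 1" "0 \<le> t" "t \<le> 1"
  shows "s\<^sup>2 + t\<^sup>2 + (b * s - a * t)\<^sup>2 \<le> 2 + (37/100)\<^sup>2"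
proof -
  let ?M = "2 + (37/100)\<^sup>2 :: real"
  have sq: "a\<^sup>2 \<le> 1" "b\<^sup>2 \<le> 1" "s\<^sup>2 \<le> 1" using ab st by (auto simp: power_le_one)
  have "\<bar>b - a\<bar> \<le> 37/100" using ab by linarith
  then have d: "(b - a)\<^sup>2 \<le> (37/100)\<^sup>2" by (metis abs_le_square_iff abs_numeral abs_divide)
  have "s\<^sup>2 * (1 + b\<^sup>2) \<le> 1 * 2" using sq by (intro mult_mono) auto
  moreover have "s\<^sup>2 * (1 + b\<^sup>2) = s\<^sup>2 + (b * s)\<^sup>2" by (simp add: power2_eq_square algebra_simps)
  ultimately have 0: "s\<^sup>2 + (b * s)\<^sup>2 \<le> ?M" using zero_le_power2[of "37/100 :: real"] by linarith
  have "(1 + b\<^sup>2) * s\<^sup>2 + (- 2 * a * b) * s + (1 + a\<^sup>2) \<le> ?M"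
    using sq st d by (intro quadratic_le_max_endpoints) (auto simp: power2_eq_square algebra_simps)
  then have 1: "(1 + a\<^sup>2) + (- 2 * a * b * s) + (s\<^sup>2 + (b * s)\<^sup>2) \<le> ?M"
    by (simp add: power2_eq_square algebra_simps)
  have "(1 + a\<^sup>2) * t\<^sup>2 + (- 2 * a * b * s) * t + (s\<^sup>2 + (b * s)\<^sup>2) \<le> ?M"
    using 0 1 st by (intro quadratic_le_max_endpoints) auto
  then show ?thesis by (simp add: power2_eq_square algebra_simps)
qed

text \<open>Here the third determinant is \<open>r (b s + a t)\<close>, which cannot exceed
  \<open>r\<close>. This relaxes to \<open>s <= 159/100 - 122/100 t\<close>, with equality at
  \<open>t = 1\<close>, \<open>s = 37/100\<close>, where the bound is attained;
  \<open>s <= t\<close> settles small \<open>t\<close>.\<close>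

lemma opposite_side_bound_aux:
  fixes a b s t :: real
  assumes ab: "0 \<le> a" "a \<le> 1" "b \<le> 1" "1 - b \<le> 37/100 * a" "1 - a \<le> 37/100 * b"
    and st: "0 \<le> s" "0 \<le> t" "t \<le> 1" "s \<le> t" "b * s + a * t \<le> 1"
  shows "s\<^sup>2 + t\<^sup>2 \<le> 1 + (37/100)\<^sup>2"
proof -
  have b: "63/100 \<le> b" using ab by simp
  have "t * (1 - 37/100 * b) \<le> t * a" using ab st by (intro mult_left_mono) auto
  then have 1: "b * (s - 37/100 * t) \<le> 1 - t" using st by (simp add: algebra_simps)
  have "63/100 * (s - 37/100 * t) \<le> 1 - t"
  proof (cases "s - 37/100 * t \<ge> 0")
    case True
    then have "63/100 * (s - 37/100 * t) \<le> b * (s - 37/100 * t)" using b by (intro mult_right_mono)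
    with 1 show ?thesis by simp
  qed (use st in auto)
  then have s: "s \<le> 159/100 - 122/100 * t" using st by simp
  show ?thesis
  proof (cases "t \<le> 3/4")
    case True
    have "t\<^sup>2 \<le> (3/4)\<^sup>2" "s\<^sup>2 \<le> (3/4)\<^sup>2" using True st by (auto intro!: power_mono)
    then show ?thesis by (simp add: power2_eq_square)
  next
    case False
    have "0 \<le> (t - 3/4) * (1 - t)" using False st by simp
    then have "t\<^sup>2 \<le> 7/4 * t - 3/4" by (simp add: power2_eq_square field_simps)
    moreover have "s\<^sup>2 \<le> (159/100 - 122/100 * t)\<^sup>2" using s st by (intro power_mono)
    then have "s\<^sup>2 \<le> 25281/10000 - 38796/10000 * t + 14884/10000 * t\<^sup>2"
      by (simp add: power2_eq_square field_simps)
    moreover have "(37/100 :: real)\<^sup>2 = 1369/10000" by (simp add: power2_eq_square)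
    ultimately show ?thesis using st by linarith
  qed
qed

lemma opposite_side_bound:
  fixes a b s t :: real
  assumes "0 \<le> a" "a \<le> 1" "0 \<le> b" "b \<le> 1" "1 - b \<le> 37/100 * a" "1 - a \<le> 37/100 * b"
    and "0 \<le> s" "s \<le> 1" "0 \<le> t" "t \<le> 1" "b * s + a * t \<le> 1"
  shows "s\<^sup>2 + t\<^sup>2 \<le> 1 + (37/100)\<^sup>2"
proof (cases "s \<le> t")
  case True
  with assms show ?thesis by (intro opposite_side_bound_aux[of a b]) auto
next
  case False
  with assms have "t\<^sup>2 + s\<^sup>2 \<le> 1 + (37/100)\<^sup>2"
    by (intro opposite_side_bound_aux[of b a]) (auto simp: algebra_simps)
  then show ?thesis by simp
qed

text \<open>Dividing by \<open>r\<close> leads to the lemmas above. The first bound is the weight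
  inside a bad triple, the second the weight between it and a further vector, whose determinants
  \<open>x\<close>, \<open>y\<close>, \<open>d\<close> obey the Pluecker relation.\<close>

lemma bad_triple_bounds:
  fixes p q r :: real
  assumes r: "0 < r" "r \<le> 1" and pq: "\<bar>p\<bar> \<le> r" "\<bar>q\<bar> \<le> r" and bad: "1 < p\<^sup>2 + q\<^sup>2"
    and hex: "r \<le> \<bar>p\<bar> + \<bar>q\<bar> \<Longrightarrow> (\<bar>p\<bar> + \<bar>q\<bar> - r)\<^sup>2 \<le> 4 * \<bar>p\<bar> * \<bar>q\<bar> * (1 - r)"
  shows "r\<^sup>2 + p\<^sup>2 + q\<^sup>2 \<le> 2"
    and "\<lbrakk>\<bar>x\<bar> \<le> r; \<bar>y\<bar> \<le> r; \<bar>d\<bar> \<le> r; r * \<bar>d\<bar> = \<bar>q * x - p * y\<bar>\<rbrakk> \<Longrightarrow> x\<^sup>2 + y\<^sup>2 + d\<^sup>2 \<le> 3/2"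
proof -
  define a b where "a = \<bar>p\<bar> / r" and "b = \<bar>q\<bar> / r"
  have ab: "0 \<le> a" "a \<le> 1" "0 \<le> b" "b \<le> 1" using r pq by (auto simp: a_def b_def)
  have pq': "\<bar>p\<bar> = r * a" "\<bar>q\<bar> = r * b" using r by (auto simp: a_def b_def)
  then have sq: "p\<^sup>2 = r\<^sup>2 * a\<^sup>2" "q\<^sup>2 = r\<^sup>2 * b\<^sup>2" by (metis power2_abs power_mult_distrib)+
  have bad': "1 < r\<^sup>2 * (a\<^sup>2 + b\<^sup>2)" using bad sq by (simp add: algebra_simps)
  \<comment> \<open>Badness forces \<open>1 < a^2 + b^2 <= a + b\<close>, which is the premise of
    \<open>hex\<close> after scaling.\<close>
  have "a\<^sup>2 \<le> a" "b\<^sup>2 \<le> b" "r\<^sup>2 \<le> 1"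
    using ab r by (auto simp: power2_eq_square mult_left_le mult_le_one)
  moreover have "r\<^sup>2 * (a\<^sup>2 + b\<^sup>2) \<le> 1 * (a\<^sup>2 + b\<^sup>2)" using \<open>r\<^sup>2 \<le> 1\<close> by (intro mult_right_mono) auto
  ultimately have ab1: "1 \<le> a + b" using bad' by simp
  have "r * 1 \<le> r * (a + b)" using ab1 r by (intro mult_left_mono) auto
  then have "(\<bar>p\<bar> + \<bar>q\<bar> - r)\<^sup>2 \<le> 4 * \<bar>p\<bar> * \<bar>q\<bar> * (1 - r)" by (intro hex) (simp add: pq' algebra_simps)
  moreover have "r * a + r * b - r = r * (a + b - 1)" by (simp add: algebra_simps)
  ultimately have "r\<^sup>2 * (a + b - 1)\<^sup>2 \<le> r\<^sup>2 * (4 * a * b * (1 - r))"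
    unfolding pq' by (simp add: power_mult_distrib) (simp add: power2_eq_square algebra_simps)
  then have cut: "(a + b - 1)\<^sup>2 \<le> 4 * a * b * (1 - r)" using r by simp
  have "r\<^sup>2 * (1 + a\<^sup>2 + b\<^sup>2) \<le> 2" using ab ab1 r cut by (intro bad_corner_triple_sum) auto
  then show "r\<^sup>2 + p\<^sup>2 + q\<^sup>2 \<le> 2" by (simp add: sq algebra_simps)
  have r8: "r \<le> 837/1000" using ab ab1 r cut bad' by (intro bad_corner_scale[of a b]) auto
  have ax: "1 - b \<le> 37/100 * a" "1 - a \<le> 37/100 * b"
    using ab r r8 bad' bad_corner_near_axis[of a b r] bad_corner_near_axis[of b a r]
    by (auto simp: add.commute)
  show "x\<^sup>2 + y\<^sup>2 + d\<^sup>2 \<le> 3/2"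
    if xy: "\<bar>x\<bar> \<le> r" "\<bar>y\<bar> \<le> r" "\<bar>d\<bar> \<le> r" and d: "r * \<bar>d\<bar> = \<bar>q * x - p * y\<bar>"
  proof -
    define s t e where "s = \<bar>x\<bar> / r" and "t = \<bar>y\<bar> / r" and "e = \<bar>d\<bar> / r"
    have st: "0 \<le> s" "s \<le> 1" "0 \<le> t" "t \<le> 1" "0 \<le> e" "e \<le> 1"
      using r xy by (auto simp: s_def t_def e_def)
    have xy': "\<bar>x\<bar> = r * s" "\<bar>y\<bar> = r * t" "\<bar>d\<bar> = r * e" using r by (auto simp: s_def t_def e_def)
    then have sq': "x\<^sup>2 = r\<^sup>2 * s\<^sup>2" "y\<^sup>2 = r\<^sup>2 * t\<^sup>2" "d\<^sup>2 = r\<^sup>2 * e\<^sup>2"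
      by (metis power2_abs power_mult_distrib)+
    have scale: "c = \<bar>e'\<bar>" if "r * r * c = \<bar>r * r * e'\<bar>" for c e' :: real
      using that r by (simp add: abs_mult)
    \<comment> \<open>The relative sign of \<open>q x\<close> and \<open>p y\<close> separates the
      same-side case from the opposite-side case, in which \<open>|d| <= r\<close> gives
      \<open>b s + a t <= 1\<close>.\<close>
    have "\<bar>q * x - p * y\<bar> = \<bar>\<bar>q\<bar> * \<bar>x\<bar> - \<bar>p\<bar> * \<bar>y\<bar>\<bar> \<or> \<bar>q * x - p * y\<bar> = \<bar>q\<bar> * \<bar>x\<bar> + \<bar>p\<bar> * \<bar>y\<bar>"
      unfolding abs_mult[symmetric] by linarith
    then have "s\<^sup>2 + t\<^sup>2 + e\<^sup>2 \<le> 2 + (37/100)\<^sup>2"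
    proof
      assume "\<bar>q * x - p * y\<bar> = \<bar>\<bar>q\<bar> * \<bar>x\<bar> - \<bar>p\<bar> * \<bar>y\<bar>\<bar>"
      with d have "r * r * e = \<bar>r * r * (b * s - a * t)\<bar>" by (simp add: pq' xy' algebra_simps)
      then have "e = \<bar>b * s - a * t\<bar>" by (rule scale)
      then show ?thesis using same_side_bound[OF ab ax st(1-4)] by simp
    next
      assume "\<bar>q * x - p * y\<bar> = \<bar>q\<bar> * \<bar>x\<bar> + \<bar>p\<bar> * \<bar>y\<bar>"
      with d have "r * r * e = r * r * (b * s + a * t)" by (simp add: pq' xy' algebra_simps)
      then have "b * s + a * t \<le> 1" using st r by simp
      with opposite_side_bound[OF ab ax st(1-4)] have "s\<^sup>2 + t\<^sup>2 \<le> 1 + (37/100)\<^sup>2" .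
      moreover have "e\<^sup>2 \<le> 1" using st by (simp add: power_le_one)
      ultimately show ?thesis by simp
    qed
    moreover have "r\<^sup>2 \<le> (837/1000)\<^sup>2" using r8 r by (intro power_mono) auto
    ultimately have "r\<^sup>2 * (s\<^sup>2 + t\<^sup>2 + e\<^sup>2) \<le> (837/1000)\<^sup>2 * (2 + (37/100)\<^sup>2)" by (intro mult_mono) auto
    also have "\<dots> \<le> 3/2" by (simp add: power2_eq_square)
    finally show ?thesis by (simp add: sq' algebra_simps)
  qed
qed

subsection \<open>A Mantel-type bound for planar determinants\<close>

definition turan_number :: "nat \<Rightarrow> nat" where
  "turan_number n = (n div 2) * (n - n div 2)"

text \<open>Removing a pair may cost \<open>1\<close> for the pair and \<open>1\<close> for each of
  the \<open>n\<close> remaining vectors.\<close>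

lemma turan_number_add_2: "turan_number (n + 2) = turan_number n + n + 1"
proof (cases "even n")
  case True
  then obtain k where "n = 2 * k" by blast
  then show ?thesis by (simp add: turan_number_def)
next
  case False
  then obtain k where "n = 2 * k + 1" by (meson oddE)
  then show ?thesis by (simp add: turan_number_def Suc_diff_le)
qed

text \<open>Doubled budget for removing a triple: \<open>2\<close> inside the triple and
  \<open>3/2\<close> for each of the \<open>n\<close> remaining vectors. For even \<open>n\<close>
  there is no slack.\<close>

lemma turan_number_add_3: "2 * turan_number n + 4 + 3 * n \<le> 2 * turan_number (n + 3)"
proof (cases "even n")
  case True
  then obtain k where n: "n = 2 * k" by blast
  moreover have "(2 * k + 3) div 2 = k + 1" "2 * k + 3 - (k + 1) = k + 2" by simp_all
  ultimately show ?thesis by (simp only: turan_number_def) (simp add: algebra_simps)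
next
  case False
  then obtain k where n: "n = 2 * k + 1" by (meson oddE)
  moreover have "(2 * k + 1 + 3) div 2 = k + 2" "2 * k + 1 + 3 - (k + 2) = k + 2" 
    "(2 * k + 1) div 2 = k" "2 * k + 1 - k = k + 1" by simp_all
  ultimately show ?thesis by (simp only: turan_number_def) (simp add: algebra_simps)
qed

definition det2 :: "real^2 \<Rightarrow> real^2 \<Rightarrow> real" where
  "det2 u v = u $ 1 * v $ 2 - u $ 2 * v $ 1"

lemma det2_self [simp]: "det2 u u = 0"
  by (simp add: det2_def)

lemma det2_commute_sq: "(det2 u v)\<^sup>2 = (det2 v u)\<^sup>2"
  by (simp add: det2_def power2_eq_square algebra_simps)

lemma abs_det2_commute: "\<bar>det2 u v\<bar> = \<bar>det2 v u\<bar>"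
  by (simp add: det2_def abs_minus_commute mult.commute)

lemma det2_plucker: "det2 a b * det2 c d = det2 a c * det2 b d - det2 b c * det2 a d"
  by (simp add: det2_def algebra_simps)

lemma sum_det2_sq_insert:
  assumes "finite S" "i \<notin> S"
  shows "(\<Sum>j\<in>insert i S. \<Sum>k\<in>insert i S. (det2 (v j) (v k))\<^sup>2)
    = (\<Sum>j\<in>S. \<Sum>k\<in>S. (det2 (v j) (v k))\<^sup>2) + 2 * (\<Sum>k\<in>S. (det2 (v i) (v k))\<^sup>2)"
  using assms by (simp add: sum.distrib det2_commute_sq[of _ "v i"])

text \<open>If \<open>z = a u + b w\<close> with \<open>a = p/r\<close>, \<open>b = q/r\<close>, the region \<open>\<bar>u \<bullet> x\<bar>, \<bar>w \<bullet> x\<bar>, \<bar>z \<bullet> x\<bar> \<le> 1\<close> is a parallelogram of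
  area \<open>4/r\<close> with two corners cut off, and the condition says that its area is at least \<open>4\<close>.\<close>
definition hex_condition :: "real^2 \<Rightarrow> real^2 \<Rightarrow> real^2 \<Rightarrow> bool" where
  "hex_condition u w z \<longleftrightarrow>
     (let r = \<bar>det2 u w\<bar>; p = \<bar>det2 w z\<bar>; q = \<bar>det2 u z\<bar> in
      p \<le> r \<longrightarrow> q \<le> r \<longrightarrow> r \<le> p + q \<longrightarrow> (p + q - r)\<^sup>2 \<le> 4 * p * q * (1 - r))"

text \<open>Induction in the style of Mantel's theorem: remove the pair \<open>i\<close>, \<open>j\<close> of largest determinant if there is no
  bad \<open>k\<close>, and the triple \<open>i\<close>, \<open>j\<close>, \<open>k\<close> otherwise.\<close>
lemma sum_det2_sq_le_turan:
  fixes v :: "'i \<Rightarrow> real^2"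
  assumes "finite S"
    and "\<And>i j. i \<in> S \<Longrightarrow> j \<in> S \<Longrightarrow> \<bar>det2 (v i) (v j)\<bar> \<le> 1"
    and "\<And>i j k. i \<in> S \<Longrightarrow> j \<in> S \<Longrightarrow> k \<in> S \<Longrightarrow> hex_condition (v i) (v j) (v k)"
  shows "(\<Sum>i\<in>S. \<Sum>j\<in>S. (det2 (v i) (v j))\<^sup>2) \<le> 2 * real (turan_number (card S))"
  using assms
proof (induction "card S" arbitrary: S rule: less_induct)
  case less
  define D where "D i j = det2 (v i) (v j)" for i j
  \<comment> \<open>Ordered pairs are summed, so every unordered pair counts twice; hence the
    factors 2 below.\<close>
  define F where "F T = (\<Sum>i\<in>T. \<Sum>j\<in>T. (D i j)\<^sup>2)" for T
  have F_insert: "F (insert i T) = F T + 2 * (\<Sum>k\<in>T. (D i k)\<^sup>2)" if "finite T" "i \<notin> T" for i T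
    using sum_det2_sq_insert[OF that, of v] by (simp add: F_def D_def)
  have IH: "F T \<le> 2 * real (turan_number (card T))" if "T \<subset> S" for T
    unfolding F_def D_def
  proof (rule less.hyps)
    show "card T < card S" using that less.prems(1) by (rule psubset_card_mono[rotated])
    show "finite T" using that less.prems(1) by (auto intro: finite_subset)
  qed (use that less.prems(2,3) in blast)+
  have comm: "\<bar>D i j\<bar> = \<bar>D j i\<bar>" for i j unfolding D_def by (rule abs_det2_commute)
  have sqcomm: "(D i j)\<^sup>2 = (D j i)\<^sup>2" for i j unfolding D_def by (rule det2_commute_sq)
  have "F S \<le> 2 * real (turan_number (card S))"
  proof (cases "\<exists>i\<in>S. \<exists>j\<in>S. D i j \<noteq> 0")
    case False
    then have "F S = 0" by (simp add: F_def)
    then show ?thesis by simp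
  next
    case True
    let ?M = "Max ((\<lambda>(i, j). \<bar>D i j\<bar>) ` (S \<times> S))"
    have "?M \<in> (\<lambda>(i, j). \<bar>D i j\<bar>) ` (S \<times> S)"
      using True less.prems(1) by (intro Max_in) auto
    then obtain i j where ij: "i \<in> S" "j \<in> S" "?M = \<bar>D i j\<bar>" by auto
    have max: "\<bar>D k l\<bar> \<le> \<bar>D i j\<bar>" if "k \<in> S" "l \<in> S" for k l
      unfolding ij(3)[symmetric] using that less.prems(1) by (intro Max_ge) force+
    define r where "r = \<bar>D i j\<bar>"
    have r: "0 < r" "r \<le> 1"
      using True max ij less.prems(2) unfolding r_def D_def by (fastforce, blast)
    then have "i \<noteq> j" by (auto simp: r_def D_def)
    show ?thesis
    proof (cases "\<forall>k\<in>S. (D i k)\<^sup>2 + (D j k)\<^sup>2 \<le> 1")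
      case True
      define T where "T = S - {i, j}"
      have T: "finite T" "S = insert i (insert j T)" "i \<notin> insert j T" "j \<notin> T"
        using ij \<open>i \<noteq> j\<close> less.prems(1) by (auto simp: T_def)
      then have card: "card S = card T + 2" using \<open>i \<noteq> j\<close> by simp
      have "F S = F T + 2 * (D i j)\<^sup>2 + 2 * (\<Sum>k\<in>T. (D i k)\<^sup>2 + (D j k)\<^sup>2)"
        using T by (simp add: F_insert sum.distrib)
      moreover have "(\<Sum>k\<in>T. (D i k)\<^sup>2 + (D j k)\<^sup>2) \<le> real (card T) * 1"
        using True by (intro sum_bounded_above) (auto simp: T_def)
      moreover have "(D i j)\<^sup>2 \<le> 1" using r by (simp add: r_def abs_square_le_1)
      moreover have "F T \<le> 2 * real (turan_number (card T))" using ij by (intro IH) (auto simp: T_def)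
      ultimately show ?thesis unfolding card turan_number_add_2 by simp
    next
      case False
      then obtain k where k: "k \<in> S" "1 < (D i k)\<^sup>2 + (D j k)\<^sup>2" by force
      have ik: "\<bar>D i k\<bar> \<le> r" "\<bar>D j k\<bar> \<le> r" using max ij k by (auto simp: r_def)
      have r_sq: "r\<^sup>2 \<le> 1" using r by (simp add: power_le_one)
      \<comment> \<open>For \<open>k = i\<close> or \<open>k = j\<close>, badness would read
        \<open>1 < r^2\<close>.\<close>
      have "k \<noteq> i" "k \<noteq> j"
        using k(2) r_sq by (auto simp: r_def D_def det2_commute_sq[of "v j" "v i"])
      have hex: "(\<bar>D j k\<bar> + \<bar>D i k\<bar> - r)\<^sup>2 \<le> 4 * \<bar>D j k\<bar> * \<bar>D i k\<bar> * (1 - r)"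
        if "r \<le> \<bar>D j k\<bar> + \<bar>D i k\<bar>"
        using less.prems(3)[OF ij(1,2) k(1)] that ik by (simp add: hex_condition_def Let_def r_def D_def)
      have bad: "1 < (D j k)\<^sup>2 + (D i k)\<^sup>2" using k by simp
      \<comment> \<open>Here \<open>p\<close> is \<open>D j k\<close> and \<open>q\<close> is
        \<open>D i k\<close>: up to sign, \<open>r\<close> times the coordinates of
        \<open>v k\<close> with respect to \<open>v i\<close> and \<open>v j\<close>.\<close>
      note bounds = bad_triple_bounds[OF r ik(2,1) bad hex]
      define T where "T = S - {i, j, k}"
      have T: "finite T" "S = insert i (insert j (insert k T))"
        "i \<notin> insert j (insert k T)" "j \<notin> insert k T" "k \<notin> T"
        using ij k \<open>i \<noteq> j\<close> \<open>k \<noteq> i\<close> \<open>k \<noteq> j\<close> less.prems(1) by (auto simp: T_def)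
      then have card: "card S = card T + 3"
        using \<open>i \<noteq> j\<close> \<open>k \<noteq> i\<close> \<open>k \<noteq> j\<close> by simp
      have "F S = F T + 2 * ((D i j)\<^sup>2 + (D j k)\<^sup>2 + (D i k)\<^sup>2)
          + 2 * (\<Sum>l\<in>T. (D j l)\<^sup>2 + (D i l)\<^sup>2 + (D k l)\<^sup>2)"
        using T by (simp add: F_insert sum.distrib)
      moreover have "(\<Sum>l\<in>T. (D j l)\<^sup>2 + (D i l)\<^sup>2 + (D k l)\<^sup>2) \<le> card T * (3/2)"
      proof (intro sum_bounded_above)
        fix l assume "l \<in> T"
        then have l: "l \<in> S" by (simp add: T_def)
        have "r * \<bar>D k l\<bar> = \<bar>D i k * D j l - D j k * D i l\<bar>"
          unfolding r_def abs_mult[symmetric] D_def det2_plucker[of "v i" "v j" "v k"] ..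
        with l show "(D j l)\<^sup>2 + (D i l)\<^sup>2 + (D k l)\<^sup>2 \<le> 3/2"
          using max ij k by (intro bounds(2)) (auto simp: r_def)
      qed
      moreover have "(D i j)\<^sup>2 + (D j k)\<^sup>2 + (D i k)\<^sup>2 \<le> 2" using bounds(1) by (simp add: r_def)
      moreover have "F T \<le> 2 * real (turan_number (card T))" using ij by (intro IH) (auto simp: T_def)
      moreover have "2 * real (turan_number (card T)) + 4 + 3 * real (card T)
          \<le> 2 * real (turan_number (card S))"
        using turan_number_add_3[of "card T"] unfolding card by linarith
      ultimately show ?thesis by simp
    qed
  qed
  then show ?case by (simp add: F_def D_def)
qed

subsection \<open>Areas of hexagons\<close>

lemma measure_std_cube_2:
  "(std_cube :: (real^2) set) \<in> lmeasurable" "measure lebesgue (std_cube :: (real^2) set) = 4"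
proof -
  have eq: "(std_cube :: (real^2) set) = cbox (\<chi> i. - 1) (\<chi> i. 1)"
    by (auto simp: std_cube_def mem_box_cart abs_le_iff minus_le_iff)
  show "(std_cube :: (real^2) set) \<in> lmeasurable" by (simp add: eq)
  have "measure lborel (cbox (\<chi> i. - 1) (\<chi> i. 1) :: (real^2) set) = 4"
    by (subst content_cbox_cart) (auto simp: interval_eq_empty_cart)
  then show "measure lebesgue (std_cube :: (real^2) set) = 4" by (simp add: eq)
qed

lemma
  fixes u w :: "real^2"
  assumes "S \<in> lmeasurable"
  shows measurable_image_frame: "(\<lambda>y :: real^2. y $ 1 *\<^sub>R u + y $ 2 *\<^sub>R w) ` S \<in> lmeasurable" (is "?L ` S \<in> _")
    and measure_image_frame: "measure lebesgue ((\<lambda>y :: real^2. y $ 1 *\<^sub>R u + y $ 2 *\<^sub>R w) ` S)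
      = \<bar>det2 u w\<bar> * measure lebesgue S"
proof -
  have lin: "linear ?L" by (intro linearI) (auto simp: algebra_simps)
  have "det (matrix ?L) = det2 u w"
    by (simp add: det_2 matrix_def det2_def axis_def)
  then show "?L ` S \<in> lmeasurable" "measure lebesgue (?L ` S) = \<bar>det2 u w\<bar> * measure lebesgue S"
    using measurable_linear_image[OF lin assms] measure_linear_image[OF lin assms] by simp_all
qed

text \<open>Now \<open>u\<close> and \<open>w\<close> are the rows of the matrix; transposing keeps
  the determinant.\<close>

lemma
  fixes u w :: "real^2"
  assumes "S \<in> lmeasurable"
  shows measurable_image_coframe: "(\<lambda>x. vector [u \<bullet> x, w \<bullet> x] :: real^2) ` S \<in> lmeasurable"
    and measure_image_coframe: "measure lebesgue ((\<lambda>x. vector [u \<bullet> x, w \<bullet> x] :: real^2) ` S)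
      = \<bar>det2 u w\<bar> * measure lebesgue S"
proof -
  have eq: "(\<lambda>x. vector [u \<bullet> x, w \<bullet> x] :: real^2)
      = (\<lambda>y. y $ 1 *\<^sub>R vector [u $ 1, w $ 1] + y $ 2 *\<^sub>R vector [u $ 2, w $ 2])"
    by (auto simp: vec_eq_iff forall_2 inner_vec_def sum_2 algebra_simps)
  have "det2 (vector [u $ 1, w $ 1]) (vector [u $ 2, w $ 2]) = det2 u w"
    by (simp add: det2_def algebra_simps)
  then show "(\<lambda>x. vector [u \<bullet> x, w \<bullet> x] :: real^2) ` S \<in> lmeasurable"
    "measure lebesgue ((\<lambda>x. vector [u \<bullet> x, w \<bullet> x] :: real^2) ` S) = \<bar>det2 u w\<bar> * measure lebesgue S"
    unfolding eq using measurable_image_frame[OF assms] measure_image_frame[OF assms] by simp_all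
qed

text \<open>In the plane the cross-polytope is a linear image of the square: \<open>x\<close> comes
  from \<open>(x1 + x2, x1 - x2)\<close>, and the determinant is \<open>1/2\<close> in absolute
  value.\<close>

lemma measure_std_cross_2:
  "(std_cross :: (real^2) set) \<in> lmeasurable" "measure lebesgue (std_cross :: (real^2) set) = 2"
proof -
  let ?u = "vector [1/2, 1/2] :: real^2" and ?w = "vector [1/2, - 1/2] :: real^2"
  have eq: "(std_cross :: (real^2) set) = (\<lambda>y :: real^2. y $ 1 *\<^sub>R ?u + y $ 2 *\<^sub>R ?w) ` std_cube" (is "_ = ?L ` _")
  proof (intro equalityI subsetI)
    fix x :: "real^2" assume "x \<in> std_cross"
    then have "vector [x $ 1 + x $ 2, x $ 1 - x $ 2] \<in> (std_cube :: (real^2) set)"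
      by (auto simp: std_cross_def std_cube_def forall_2 sum_2)
    moreover have "x = ?L (vector [x $ 1 + x $ 2, x $ 1 - x $ 2])"
      by (auto simp: vec_eq_iff forall_2 field_simps)
    ultimately show "x \<in> ?L ` std_cube" by blast
  qed (auto simp: std_cross_def std_cube_def forall_2 sum_2)
  have "det2 ?u ?w = - 1/2" by (simp add: det2_def)
  then show "(std_cross :: (real^2) set) \<in> lmeasurable" "measure lebesgue (std_cross :: (real^2) set) = 2"
    unfolding eq measure_image_frame[OF measure_std_cube_2(1)]
    by (simp_all add: measurable_image_frame measure_std_cube_2)
qed

lemma
  fixes A B C :: "real^2"
  shows measurable_triangle: "convex hull {A, B, C} \<in> lmeasurable"
    and measure_triangle: "measure lebesgue (convex hull {A, B, C}) = \<bar>det2 (B - A) (C - A)\<bar> / 2"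
proof -
  have c: "compact (convex hull {A, B, C})" by (simp add: finite_imp_compact_convex_hull)
  then show "convex hull {A, B, C} \<in> lmeasurable" by (rule lmeasurable_compact)
  have "convex hull {A, B, C} \<in> sets lborel" using c by (auto dest: compact_imp_closed)
  then have "measure lebesgue (convex hull {A, B, C}) = measure lborel (convex hull {A, B, C})"
    by simp
  also have "\<dots> = \<bar>det2 (B - A) (C - A)\<bar> / 2"
    unfolding content_triangle det2_def by (simp add: algebra_simps abs_minus_commute)
  finally show "measure lebesgue (convex hull {A, B, C}) = \<bar>det2 (B - A) (C - A)\<bar> / 2" .
qed

lemma triangle_coord_le:
  fixes A B C x :: "real^2"
  assumes "x \<in> convex hull {A, B, C}" "a * A $ 1 + b * A $ 2 \<le> c"
    "a * B $ 1 + b * B $ 2 \<le> c" "a * C $ 1 + b * C $ 2 \<le> c"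
  shows "a * x $ 1 + b * x $ 2 \<le> c"
proof -
  have "{x. a * x $ 1 + b * x $ 2 \<le> c} = {x. (vector [a, b] :: real^2) \<bullet> x \<le> c}"
    by (simp add: inner_vec_def sum_2)
  then have "convex {x :: real^2. a * x $ 1 + b * x $ 2 \<le> c}" by (simp add: convex_halfspace_le)
  with assms(2-) have "convex hull {A, B, C} \<subseteq> {x. a * x $ 1 + b * x $ 2 \<le> c}"
    by (intro hull_minimal) auto
  with assms(1) show ?thesis by auto
qed

lemma negligible_line:
  assumes "a \<noteq> 0"
  shows "negligible {x :: real^2. a * x $ 1 + b * x $ 2 = c}"
proof -
  have "(vector [a, b] :: real^2) $ 1 \<noteq> 0 $ 1" using assms by simp
  then have "(vector [a, b] :: real^2) \<noteq> 0" by metis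
  then have "negligible {x. (vector [a, b] :: real^2) \<bullet> x = c}" by (simp add: negligible_hyperplane)
  then show ?thesis by (simp add: inner_vec_def sum_2)
qed

text \<open>The line \<open>a x1 + b x2 = 1\<close> and its mirror image cut two opposite corners
  off the square. Each is a triangle of area \<open>(a + b - 1)^2 / (2 a b)\<close> that meets
  \<open>S\<close> in a null set.\<close>

lemma measure_hexagon_le:
  fixes S :: "(real^2) set"
  assumes S: "S \<in> lmeasurable" and ab: "0 < a" "a \<le> 1" "0 < b" "b \<le> 1" "1 \<le> a + b"
    and sub: "\<And>x. x \<in> S \<Longrightarrow> \<bar>x $ 1\<bar> \<le> 1 \<and> \<bar>x $ 2\<bar> \<le> 1 \<and> \<bar>a * x $ 1 + b * x $ 2\<bar> \<le> 1"
  shows "measure lebesgue S \<le> 4 - (a + b - 1)\<^sup>2 / (a * b)"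
proof -
  \<comment> \<open>\<open>B\<close> and \<open>C\<close> are the points where the cutting line
    meets the sides \<open>x $ 1 = 1\<close> and \<open>x $ 2 = 1\<close>.\<close>
  define A B C :: "real^2" where
    "A = vector [1, 1]" and "B = vector [1, (1 - a) / b]" and "C = vector [(1 - b) / a, 1]"
  let ?T = "convex hull {A, B, C}" and ?T' = "convex hull {- A, - B, - C}"
  have area: "\<bar>det2 (B - A) (C - A)\<bar> = (a + b - 1)\<^sup>2 / (a * b)"
  proof -
    have "det2 (B - A) (C - A) = - ((a + b - 1)\<^sup>2 / (a * b))"
      using ab by (simp add: det2_def A_def B_def C_def power2_eq_square field_simps)
    moreover have "0 \<le> (a + b - 1)\<^sup>2 / (a * b)" using ab by simp
    ultimately show ?thesis by (metis abs_minus_cancel abs_of_nonneg)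
  qed
  have "det2 (- B - - A) (- C - - A) = det2 (B - A) (C - A)" by (simp add: det2_def algebra_simps)
  with area have meas: "measure lebesgue ?T = (a + b - 1)\<^sup>2 / (a * b) / 2"
    "measure lebesgue ?T' = (a + b - 1)\<^sup>2 / (a * b) / 2"
    unfolding measure_triangle by simp_all
  have coords: "a * B $ 1 + b * B $ 2 = 1" "a * C $ 1 + b * C $ 2 = 1" "1 \<le> a * A $ 1 + b * A $ 2"
    "A $ 1 = 1" "A $ 2 = 1" "B $ 1 = 1" "B $ 2 \<le> 1" "C $ 1 \<le> 1" "C $ 2 = 1"
    "0 \<le> B $ 2" "0 \<le> C $ 1"
    using ab by (auto simp: A_def B_def C_def field_simps)
  have T: "1 \<le> a * x $ 1 + b * x $ 2 \<and> 0 \<le> x $ 1 \<and> x $ 1 \<le> 1 \<and> 0 \<le> x $ 2 \<and> x $ 2 \<le> 1" if "x \<in> ?T" for x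
    using triangle_coord_le[OF that, of "- a" "- b" "- 1"]
      triangle_coord_le[OF that, of 1 0 1] triangle_coord_le[OF that, of 0 1 1]
      triangle_coord_le[OF that, of "- 1" 0 0] triangle_coord_le[OF that, of 0 "- 1" 0]
      coords by auto
  have T': "a * x $ 1 + b * x $ 2 \<le> - 1 \<and> x $ 1 \<le> 0 \<and> - 1 \<le> x $ 1 \<and> x $ 2 \<le> 0 \<and> - 1 \<le> x $ 2" if "x \<in> ?T'" for x
    using triangle_coord_le[OF that, of a b "- 1"]
      triangle_coord_le[OF that, of "- 1" 0 1] triangle_coord_le[OF that, of 0 "- 1" 1]
      triangle_coord_le[OF that, of 1 0 0] triangle_coord_le[OF that, of 0 1 0]
      coords by auto
  have "measure lebesgue (S \<union> ?T \<union> ?T') = measure lebesgue S + measure lebesgue ?T + measure lebesgue ?T'"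
  proof (rule measure_Un3_negligible)
    have "S \<inter> ?T \<subseteq> {x. a * x $ 1 + b * x $ 2 = 1}" using sub T by force
    then show "negligible (S \<inter> ?T)" by (rule negligible_subset[rotated]) (rule negligible_line, use ab in simp)
    have "S \<inter> ?T' \<subseteq> {x. a * x $ 1 + b * x $ 2 = - 1}" using sub T' by force
    then show "negligible (S \<inter> ?T')" by (rule negligible_subset[rotated]) (rule negligible_line, use ab in simp)
    have "?T \<inter> ?T' = {}" using T T' by force
    then show "negligible (?T \<inter> ?T')" by simp
  qed (use S in \<open>simp_all add: measurable_triangle\<close>)
  moreover have "measure lebesgue (S \<union> ?T \<union> ?T') \<le> measure lebesgue (std_cube :: (real^2) set)"
  proof (rule measure_mono_fmeasurable)
    show "S \<union> ?T \<union> ?T' \<subseteq> std_cube"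
      using sub T T' by (fastforce simp: std_cube_def forall_2)
    show "S \<union> ?T \<union> ?T' \<in> sets lebesgue" using S measurable_triangle by (intro sets.Un fmeasurableD)
  qed (rule measure_std_cube_2)
  ultimately show ?thesis using meas measure_std_cube_2(2) by simp
qed

text \<open>\<open>S\<close> is the cross-polytope with triangles of apex \<open>(a, b)\<close> and
  \<open>(-a, -b)\<close> attached to two opposite edges. It need not be convex, as \<open>a\<close>
  or \<open>b\<close> may exceed 1; hence the formulation through convex supersets
  \<open>Q\<close>.\<close>

lemma measure_convex_hexagon_ge:
  fixes a b :: real
  assumes "0 \<le> a" "0 \<le> b" "1 \<le> a + b"
  obtains S :: "(real^2) set" where "S \<in> lmeasurable" "measure lebesgue S = 1 + a + b"
    "\<And>Q. \<lbrakk>convex Q; \<And>s. \<lbrakk>s = 1 \<or> s = -1\<rbrakk> \<Longrightarrow> vector [s, 0] \<in> Q \<and> vector [0, s] \<in> Q \<and> vector [s * a, s * b] \<in> Q\<rbrakk>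
      \<Longrightarrow> S \<subseteq> Q"
proof
  define A B C :: "real^2" where
    "A = vector [1, 0]" and "B = vector [0, 1]" and "C = vector [a, b]"
  let ?T = "convex hull {A, B, C}" and ?T' = "convex hull {- A, - B, - C}"
  let ?S = "std_cross \<union> ?T \<union> ?T'"
  show "?S \<in> lmeasurable"
    using measure_std_cross_2 measurable_triangle by (intro fmeasurable.Un)
  have area: "\<bar>det2 (B - A) (C - A)\<bar> = a + b - 1"
    using assms by (simp add: det2_def A_def B_def C_def)
  have "det2 (- B - - A) (- C - - A) = det2 (B - A) (C - A)" by (simp add: det2_def algebra_simps)
  with area have meas: "measure lebesgue ?T = (a + b - 1) / 2" "measure lebesgue ?T' = (a + b - 1) / 2"
    unfolding measure_triangle by simp_all
  have T: "1 \<le> x $ 1 + x $ 2" if "x \<in> ?T" for x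
    using triangle_coord_le[OF that, of "- 1" "- 1" "- 1"] assms by (auto simp: A_def B_def C_def)
  have T': "x $ 1 + x $ 2 \<le> - 1" if "x \<in> ?T'" for x
    using triangle_coord_le[OF that, of 1 1 "- 1"] assms by (auto simp: A_def B_def C_def)
  have cross: "\<bar>x $ 1 + x $ 2\<bar> \<le> 1" if "x \<in> std_cross" for x :: "real^2"
    using that by (auto simp: std_cross_def sum_2)
  have "measure lebesgue ?S
      = measure lebesgue (std_cross :: (real^2) set) + measure lebesgue ?T + measure lebesgue ?T'"
  proof (rule measure_Un3_negligible)
    have "std_cross \<inter> ?T \<subseteq> {x. 1 * x $ 1 + 1 * x $ 2 = 1}" using cross T by force
    then show "negligible (std_cross \<inter> ?T)" by (rule negligible_subset[rotated]) (rule negligible_line, simp)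
    have "std_cross \<inter> ?T' \<subseteq> {x. 1 * x $ 1 + 1 * x $ 2 = - 1}" using cross T' by force
    then show "negligible (std_cross \<inter> ?T')" by (rule negligible_subset[rotated]) (rule negligible_line, simp)
    have "?T \<inter> ?T' = {}" using T T' by force
    then show "negligible (?T \<inter> ?T')" by simp
  qed (simp_all add: measurable_triangle measure_std_cross_2)
  then show "measure lebesgue ?S = 1 + a + b" using meas measure_std_cross_2(2) by simp
  fix Q :: "(real^2) set"
  assume Q: "convex Q"
    "\<And>s. \<lbrakk>s = 1 \<or> s = -1\<rbrakk> \<Longrightarrow> vector [s, 0] \<in> Q \<and> vector [0, s] \<in> Q \<and> vector [s * a, s * b] \<in> Q"
  have pts: "A \<in> Q" "B \<in> Q" "C \<in> Q" using Q(2)[of 1] by (auto simp: A_def B_def C_def)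
  have neg: "- A = vector [- 1, 0]" "- B = vector [0, - 1]" "- C = vector [- a, - b]"
    by (auto simp: A_def B_def C_def vec_eq_iff forall_2)
  have npts: "- A \<in> Q" "- B \<in> Q" "- C \<in> Q" unfolding neg using Q(2)[of "-1"] by auto
  have "x \<in> Q" if "x \<in> std_cross" for x
  proof -
    have "(1/2) *\<^sub>R A + (1/2) *\<^sub>R (- A) \<in> Q" using Q(1) pts npts by (intro convexD) auto
    then have 0: "0 \<in> Q" by simp
    \<comment> \<open>The triangle of the quadrant of \<open>x\<close>; where \<open>sgn\<close> is
      0 its vertex collapses to the origin, which lies in \<open>Q\<close> too.\<close>
    let ?A = "sgn (x $ 1) *\<^sub>R A" and ?B = "sgn (x $ 2) *\<^sub>R B"
    have "{?A, ?B, 0} \<subseteq> Q"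
      using 0 pts npts by (auto simp: sgn_if)
    then have "convex hull {?A, ?B, 0} \<subseteq> Q" using Q(1) by (rule hull_minimal)
    moreover have "x \<in> convex hull {?A, ?B, 0}"
    proof -
      have "x = \<bar>x $ 1\<bar> *\<^sub>R ?A + \<bar>x $ 2\<bar> *\<^sub>R ?B + (1 - \<bar>x $ 1\<bar> - \<bar>x $ 2\<bar>) *\<^sub>R 0"
        by (auto simp: vec_eq_iff forall_2 A_def B_def abs_mult_sgn)
      moreover have "\<bar>x $ 1\<bar> + \<bar>x $ 2\<bar> \<le> 1" using that by (simp add: std_cross_def sum_2)
      ultimately show ?thesis unfolding convex_hull_3 by fastforce
    qed
    ultimately show ?thesis by blast
  qed
  then show "?S \<subseteq> Q"
    using hull_minimal[of "{A, B, C}" Q] hull_minimal[of "{- A, - B, - C}" Q] pts npts Q(1)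
    by (metis Un_least empty_subsetI insert_subset subsetI)
qed

lemma det2_expand: "det2 u w *\<^sub>R z = det2 z w *\<^sub>R u + det2 u z *\<^sub>R w"
  by (simp add: vec_eq_iff forall_2 det2_def algebra_simps)

text \<open>Cramer's rule with the signs moved onto \<open>u\<close> and \<open>w\<close>: symmetric
  sets do not see them, and the coefficients become nonnegative.\<close>

lemma sign_expand:
  fixes u w z :: "real^2"
  assumes "det2 u w \<noteq> 0"
  obtains s t where "\<bar>s\<bar> = 1" "\<bar>t\<bar> = 1"
    "z = (\<bar>det2 w z\<bar> / \<bar>det2 u w\<bar>) *\<^sub>R (s *\<^sub>R u) + (\<bar>det2 u z\<bar> / \<bar>det2 u w\<bar>) *\<^sub>R (t *\<^sub>R w)"
proof -
  \<comment> \<open>\<open>sgn\<close> itself will not do, because its value at 0 is 0.\<close>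
  have sgn: "\<exists>s. \<bar>s\<bar> = 1 \<and> c = \<bar>c\<bar> * s" for c :: real
    by (rule exI[of _ "if c < 0 then - 1 else 1"]) auto
  obtain s where s: "\<bar>s\<bar> = 1" "det2 z w / det2 u w = \<bar>det2 z w / det2 u w\<bar> * s"
    using sgn by blast
  obtain t where t: "\<bar>t\<bar> = 1" "det2 u z / det2 u w = \<bar>det2 u z / det2 u w\<bar> * t"
    using sgn by blast
  have "z = (1 / det2 u w) *\<^sub>R (det2 u w *\<^sub>R z)" using assms by simp
  also have "\<dots> = (det2 z w / det2 u w) *\<^sub>R u + (det2 u z / det2 u w) *\<^sub>R w"
    by (subst det2_expand) (simp add: scaleR_add_right)
  also have "\<dots> = (\<bar>det2 w z\<bar> / \<bar>det2 u w\<bar>) *\<^sub>R (s *\<^sub>R u) + (\<bar>det2 u z\<bar> / \<bar>det2 u w\<bar>) *\<^sub>R (t *\<^sub>R w)"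
    by (subst s(2), subst t(2)) (simp add: abs_divide abs_det2_commute[of z w])
  finally show ?thesis using s(1) t(1) that by blast
qed

text \<open>In the basis \<open>s u\<close>, \<open>t w\<close> the point \<open>z\<close> becomes
  \<open>(a, b)\<close> with nonnegative coordinates, so the hexagon of area
  \<open>1 + a + b\<close> applies and is scaled by \<open>r\<close>.\<close>

lemma measure_convex_ge_hexagon:
  fixes u w z :: "real^2"
  assumes P: "convex P" "P \<in> lmeasurable"
    and pts: "\<And>x. x \<in> {u, w, z} \<Longrightarrow> x \<in> P \<and> - x \<in> P"
    and le: "\<bar>det2 u w\<bar> \<le> \<bar>det2 w z\<bar> + \<bar>det2 u z\<bar>"
    and nz: "det2 u w \<noteq> 0"
  shows "\<bar>det2 u w\<bar> + \<bar>det2 w z\<bar> + \<bar>det2 u z\<bar> \<le> measure lebesgue P"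
proof -
  define r a b where "r = \<bar>det2 u w\<bar>" and "a = \<bar>det2 w z\<bar> / r" and "b = \<bar>det2 u z\<bar> / r"
  have r: "r > 0" using nz by (simp add: r_def)
  have ab: "0 \<le> a" "0 \<le> b" "1 \<le> a + b" using r le by (auto simp: a_def b_def r_def field_simps)
  obtain s t where st: "\<bar>s\<bar> = 1" "\<bar>t\<bar> = 1" "z = a *\<^sub>R (s *\<^sub>R u) + b *\<^sub>R (t *\<^sub>R w)"
    using sign_expand[OF nz, of z] unfolding a_def b_def r_def by metis
  let ?L = "\<lambda>y :: real^2. y $ 1 *\<^sub>R (s *\<^sub>R u) + y $ 2 *\<^sub>R (t *\<^sub>R w)"
  have lin: "linear ?L" by (intro linearI) (auto simp: algebra_simps)
  obtain S :: "(real^2) set" where S: "S \<in> lmeasurable" "measure lebesgue S = 1 + a + b"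
    "\<And>Q. \<lbrakk>convex Q; \<And>s. \<lbrakk>s = 1 \<or> s = -1\<rbrakk> \<Longrightarrow> vector [s, 0] \<in> Q \<and> vector [0, s] \<in> Q \<and> vector [s * a, s * b] \<in> Q\<rbrakk>
      \<Longrightarrow> S \<subseteq> Q"
    using measure_convex_hexagon_ge[OF ab] by metis
  have scale: "c *\<^sub>R x \<in> P" if "x \<in> {u, w, z}" "\<bar>c\<bar> = 1" for c x
  proof -
    have "c = 1 \<or> c = - 1" using that(2) by linarith
    with pts[OF that(1)] show ?thesis by auto
  qed
  have "S \<subseteq> ?L -` P"
  proof (rule S(3))
    show "convex (?L -` P)" using lin P(1) by (rule convex_linear_vimage)
    fix c :: real assume c: "c = 1 \<or> c = - 1"
    then have "\<bar>c * s\<bar> = 1" "\<bar>c * t\<bar> = 1" "\<bar>c\<bar> = 1" using st by (auto simp: abs_mult)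
    moreover have "(c * a) *\<^sub>R (s *\<^sub>R u) + (c * b) *\<^sub>R (t *\<^sub>R w) = c *\<^sub>R z"
      by (simp add: st(3) scaleR_add_right mult.assoc)
    ultimately show "vector [c, 0] \<in> ?L -` P \<and> vector [0, c] \<in> ?L -` P \<and> vector [c * a, c * b] \<in> ?L -` P"
      using scale[of u "c * s"] scale[of w "c * t"] scale[of z c] by simp
  qed
  then have "measure lebesgue (?L ` S) \<le> measure lebesgue P"
    using P(2) measurable_image_frame[OF S(1), of "s *\<^sub>R u" "t *\<^sub>R w"]
    by (intro measure_mono_fmeasurable) (auto simp: fmeasurableD)
  moreover have "\<bar>det2 (s *\<^sub>R u) (t *\<^sub>R w)\<bar> = r"
  proof -
    have "det2 (s *\<^sub>R u) (t *\<^sub>R w) = s * t * det2 u w" by (simp add: det2_def algebra_simps)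
    then show ?thesis using st by (simp add: abs_mult r_def)
  qed
  ultimately have "r * (1 + a + b) \<le> measure lebesgue P"
    unfolding measure_image_frame[OF S(1)] S(2) by simp
  moreover have "r * a = \<bar>det2 w z\<bar>" "r * b = \<bar>det2 u z\<bar>" using r by (simp_all add: a_def b_def)
  ultimately show ?thesis by (simp add: r_def[symmetric] algebra_simps)
qed

text \<open>The inner products with \<open>s u\<close> and \<open>t w\<close> map \<open>K\<close>
  into the square and turn the third slab into \<open>|a y1 + b y2| <= 1\<close>; areas scale by
  \<open>|det2 u w|\<close>.\<close>

lemma measure_slab_hexagon_le:
  fixes u w z :: "real^2"
  assumes K: "K \<in> lmeasurable" "\<And>x y. x \<in> K \<Longrightarrow> y \<in> {u, w, z} \<Longrightarrow> \<bar>y \<bullet> x\<bar> \<le> 1"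
    and le: "\<bar>det2 w z\<bar> \<le> \<bar>det2 u w\<bar>" "\<bar>det2 u z\<bar> \<le> \<bar>det2 u w\<bar>"
      "\<bar>det2 u w\<bar> \<le> \<bar>det2 w z\<bar> + \<bar>det2 u z\<bar>"
    and pos: "det2 w z \<noteq> 0" "det2 u z \<noteq> 0"
  shows "\<bar>det2 u w\<bar> * measure lebesgue K
    \<le> 4 - (\<bar>det2 w z\<bar> + \<bar>det2 u z\<bar> - \<bar>det2 u w\<bar>)\<^sup>2 / (\<bar>det2 w z\<bar> * \<bar>det2 u z\<bar>)"
proof -
  define r a b where "r = \<bar>det2 u w\<bar>" and "a = \<bar>det2 w z\<bar> / r" and "b = \<bar>det2 u z\<bar> / r"
  have nz: "det2 u w \<noteq> 0" using le pos by auto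
  then have r: "r > 0" by (simp add: r_def)
  have ab: "0 < a" "a \<le> 1" "0 < b" "b \<le> 1" "1 \<le> a + b"
    using r le pos by (auto simp: a_def b_def r_def field_simps)
  obtain s t where st: "\<bar>s\<bar> = 1" "\<bar>t\<bar> = 1" "z = a *\<^sub>R (s *\<^sub>R u) + b *\<^sub>R (t *\<^sub>R w)"
    using sign_expand[OF nz, of z] unfolding a_def b_def r_def by metis
  let ?L = "\<lambda>x. vector [(s *\<^sub>R u) \<bullet> x, (t *\<^sub>R w) \<bullet> x] :: real^2"
  have "measure lebesgue (?L ` K) \<le> 4 - (a + b - 1)\<^sup>2 / (a * b)"
  proof (rule measure_hexagon_le)
    show "?L ` K \<in> lmeasurable" using K(1) by (rule measurable_image_coframe)
    fix y assume "y \<in> ?L ` K"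
    then obtain x where x: "x \<in> K" "y = ?L x" by blast
    have "a * y $ 1 + b * y $ 2 = z \<bullet> x" by (simp add: x(2) st(3) inner_add_left)
    then show "\<bar>y $ 1\<bar> \<le> 1 \<and> \<bar>y $ 2\<bar> \<le> 1 \<and> \<bar>a * y $ 1 + b * y $ 2\<bar> \<le> 1"
      using K(2)[OF x(1)] st by (simp add: x(2) abs_mult)
  qed (use ab in auto)
  moreover have "\<bar>det2 (s *\<^sub>R u) (t *\<^sub>R w)\<bar> = r"
  proof -
    have "det2 (s *\<^sub>R u) (t *\<^sub>R w) = s * t * det2 u w" by (simp add: det2_def algebra_simps)
    then show ?thesis using st by (simp add: abs_mult r_def)
  qed
  ultimately have "r * measure lebesgue K \<le> 4 - (a + b - 1)\<^sup>2 / (a * b)"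
    unfolding measure_image_coframe[OF K(1)] by simp
  moreover have "(a + b - 1)\<^sup>2 / (a * b) = (\<bar>det2 w z\<bar> + \<bar>det2 u z\<bar> - r)\<^sup>2 / (\<bar>det2 w z\<bar> * \<bar>det2 u z\<bar>)"
    using r pos by (simp add: a_def b_def power2_eq_square field_simps)
  ultimately show ?thesis by (simp add: r_def)
qed

lemma measure_slab_parallelogram_le:
  fixes u w :: "real^2"
  assumes "K \<in> lmeasurable" "\<And>x y. x \<in> K \<Longrightarrow> y \<in> {u, w} \<Longrightarrow> \<bar>y \<bullet> x\<bar> \<le> 1"
  shows "\<bar>det2 u w\<bar> * measure lebesgue K \<le> 4"
proof -
  let ?L = "\<lambda>x. vector [u \<bullet> x, w \<bullet> x] :: real^2"
  have "measure lebesgue (?L ` K) \<le> measure lebesgue (std_cube :: (real^2) set)"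
    using assms measure_std_cube_2(1) measurable_image_coframe[OF assms(1), of u w]
    by (intro measure_mono_fmeasurable) (auto simp: fmeasurableD std_cube_def forall_2)
  then show ?thesis by (simp add: measure_image_coframe[OF assms(1)] measure_std_cube_2)
qed

subsection \<open>Tight frames from isometric embeddings\<close>

definition isometric_embedding :: "(real^2 \<Rightarrow> real^'n) \<Rightarrow> bool" where
  "isometric_embedding f \<longleftrightarrow> linear f \<and> (\<forall>x. norm (f x) = norm x)"

lemma isometric_embedding_inner:
  assumes "isometric_embedding f"
  shows "f x \<bullet> f y = x \<bullet> y"
proof -
  have "norm (f x + f y) = norm (x + y)"
    using assms by (simp add: isometric_embedding_def linear_add[symmetric])
  then show ?thesis using assms by (simp add: dot_norm isometric_embedding_def)
qed

text \<open>The tight frame \<open>v\<^sub>1, \<dots>, v\<^sub>n\<close> of the plane with \<open>(f x)\<^sub>i = v\<^sub>i \<bullet> x\<close>.\<close>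
definition row_vec :: "(real^2 \<Rightarrow> real^'n) \<Rightarrow> 'n \<Rightarrow> real^2" where
  "row_vec f i = vector [f (axis 1 1) $ i, f (axis 2 1) $ i]"

lemma row_vec_inner:
  assumes "linear f"
  shows "f x $ i = row_vec f i \<bullet> x"
proof -
  have "f x = f (x $ 1 *\<^sub>R axis 1 1 + x $ 2 *\<^sub>R axis 2 1)"
    by (rule arg_cong[of _ _ f]) (simp add: vec_eq_iff forall_2 axis_def)
  also have "\<dots> = x $ 1 *\<^sub>R f (axis 1 1) + x $ 2 *\<^sub>R f (axis 2 1)"
    by (simp only: linear_add[OF assms] linear_scale[OF assms])
  finally have "f x $ i = x $ 1 * f (axis 1 1) $ i + x $ 2 * f (axis 2 1) $ i" by simp
  then show ?thesis by (simp add: row_vec_def inner_vec_def sum_2 mult.commute)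
qed

lemma sum_row_vec:
  assumes "linear f"
  shows "(\<Sum>i\<in>UNIV. c $ i *\<^sub>R row_vec f i) \<bullet> x = c \<bullet> f x"
  by (simp add: inner_sum_left inner_vec_def[of c] row_vec_inner[OF assms])

text \<open>Lagrange's identity for the columns \<open>p\<close> and \<open>q\<close> of
  \<open>f\<close>, which are orthonormal; ordered pairs make the value 2.\<close>

lemma sum_det2_row_vec_sq:
  assumes "isometric_embedding f"
  shows "(\<Sum>i\<in>UNIV. \<Sum>j\<in>UNIV. (det2 (row_vec f i) (row_vec f j))\<^sup>2) = 2"
proof -
  define p q where "p i = f (axis 1 1) $ i" and "q i = f (axis 2 1) $ i" for i
  have pq: "(\<Sum>i\<in>UNIV. p i * p i) = 1" "(\<Sum>i\<in>UNIV. q i * q i) = 1" "(\<Sum>i\<in>UNIV. p i * q i) = 0"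
    using isometric_embedding_inner[OF assms, of "axis 1 1" "axis 1 1"]
      isometric_embedding_inner[OF assms, of "axis 2 1" "axis 2 1"]
      isometric_embedding_inner[OF assms, of "axis 1 1" "axis 2 1"]
    by (simp_all add: p_def q_def inner_vec_def sum_2 axis_def)
  have "(\<Sum>i\<in>UNIV. \<Sum>j\<in>UNIV. (det2 (row_vec f i) (row_vec f j))\<^sup>2)
      = (\<Sum>i\<in>UNIV. \<Sum>j\<in>UNIV. (p i * p i) * (q j * q j) + (q i * q i) * (p j * p j)
          - 2 * ((p i * q i) * (p j * q j)))"
    by (simp add: det2_def row_vec_def p_def q_def power2_eq_square algebra_simps)
  also have "\<dots> = 2"
    by (simp only: sum.distrib sum_subtractf sum_distrib_left[symmetric] sum_distrib_right[symmetric] pq)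
  finally show ?thesis .
qed

text \<open>Scaling the frame by \<open>sqrt \<alpha>\<close> multiplies determinants by
  \<open>\<alpha>\<close>, so their squares sum to \<open>2 \<alpha>^2\<close>, and the Mantel-type
  bound applies to the scaled vectors.\<close>

lemma isometric_embedding_scale_bound:
  fixes f :: "real^2 \<Rightarrow> real^'n"
  assumes f: "isometric_embedding f" and \<alpha>: "0 \<le> \<alpha>"
    and det: "\<And>i j. \<alpha> * \<bar>det2 (row_vec f i) (row_vec f j)\<bar> \<le> 1"
    and hex: "\<And>i j k p q r. \<lbrakk>r = \<bar>det2 (row_vec f i) (row_vec f j)\<bar>;
        p = \<bar>det2 (row_vec f j) (row_vec f k)\<bar>; q = \<bar>det2 (row_vec f i) (row_vec f k)\<bar>;
        0 < r; 0 < p; 0 < q; p \<le> r; q \<le> r; r \<le> p + q\<rbrakk>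
      \<Longrightarrow> (p + q - r)\<^sup>2 \<le> 4 * p * q * (1 - \<alpha> * r)"
  shows "\<alpha> \<le> sqrt (turan_number CARD('n))"
proof -
  define v where "v i = sqrt \<alpha> *\<^sub>R row_vec f i" for i
  have "det2 (v i) (v j) = (sqrt \<alpha> * sqrt \<alpha>) * det2 (row_vec f i) (row_vec f j)" for i j
    unfolding v_def det2_def vector_scaleR_component real_scaleR_def by algebra
  then have v: "det2 (v i) (v j) = \<alpha> * det2 (row_vec f i) (row_vec f j)" for i j
    using \<alpha> by simp
  have "hex_condition (v i) (v j) (v k)" for i j k
  proof -
    define p q r where "p = \<bar>det2 (row_vec f j) (row_vec f k)\<bar>"
      and "q = \<bar>det2 (row_vec f i) (row_vec f k)\<bar>" and "r = \<bar>det2 (row_vec f i) (row_vec f j)\<bar>"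
    have abs: "\<bar>det2 (v i) (v j)\<bar> = \<alpha> * r" "\<bar>det2 (v j) (v k)\<bar> = \<alpha> * p" "\<bar>det2 (v i) (v k)\<bar> = \<alpha> * q"
      using \<alpha> by (simp_all add: v abs_mult p_def q_def r_def)
    have "(\<alpha> * p + \<alpha> * q - \<alpha> * r)\<^sup>2 \<le> 4 * (\<alpha> * p) * (\<alpha> * q) * (1 - \<alpha> * r)"
      if le: "\<alpha> * p \<le> \<alpha> * r" "\<alpha> * q \<le> \<alpha> * r" "\<alpha> * r \<le> \<alpha> * p + \<alpha> * q"
    proof (cases "\<alpha> = 0")
      case False
      then have "p \<le> r" "q \<le> r" "r \<le> p + q" 
        using le \<alpha> by (simp_all flip: distrib_left)
      moreover have "0 \<le> p" "0 \<le> q" by (simp_all add: p_def q_def)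
      \<comment> \<open>If \<open>p\<close> or \<open>q\<close> is 0, the other one equals
        \<open>r\<close> and both sides vanish.\<close>
      ultimately have "(p + q - r)\<^sup>2 \<le> 4 * p * q * (1 - \<alpha> * r)"
        using hex[OF r_def p_def q_def] by (cases "p = 0 \<or> q = 0") auto
      then have "\<alpha>\<^sup>2 * (p + q - r)\<^sup>2 \<le> \<alpha>\<^sup>2 * (4 * p * q * (1 - \<alpha> * r))"
        by (intro mult_left_mono) auto
      then show ?thesis by (simp add: power2_eq_square algebra_simps)
    qed simp
    then show ?thesis by (simp add: hex_condition_def Let_def abs)
  qed
  moreover have "\<bar>det2 (v i) (v j)\<bar> \<le> 1" for i j using det[of i j] \<alpha> by (simp add: v abs_mult)
  ultimately have "(\<Sum>i\<in>UNIV. \<Sum>j\<in>UNIV. (det2 (v i) (v j))\<^sup>2) \<le> 2 * real (turan_number CARD('n))"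
    by (intro sum_det2_sq_le_turan) auto
  moreover have "(\<Sum>i\<in>UNIV. \<Sum>j\<in>UNIV. (det2 (v i) (v j))\<^sup>2) = \<alpha>\<^sup>2 * 2"
    unfolding v power_mult_distrib sum_distrib_left[symmetric] sum_det2_row_vec_sq[OF f] ..
  ultimately show ?thesis by (simp add: real_le_rsqrt)
qed

section \<open>Area of sections of the cube\<close>

lemma compact_std_cube: "compact (std_cube :: (real^'n) set)"
proof -
  have eq: "(std_cube :: (real^'n) set) = cbox (\<chi> i. - 1) (\<chi> i. 1)"
    by (auto simp: std_cube_def mem_box_cart abs_le_iff minus_le_iff)
  show ?thesis unfolding eq by (rule compact_cbox)
qed

lemma lmeasurable_section:
  assumes "isometric_embedding f"
  shows "f -` (std_cube \<inter> range f) \<in> lmeasurable"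
proof (rule lmeasurable_compact)
  have eq: "f -` (std_cube \<inter> range f) = f -` std_cube" by auto
  obtain B where "norm y \<le> B" if "y \<in> (std_cube :: (real^'a) set)" for y
    using compact_imp_bounded[OF compact_std_cube] unfolding bounded_iff by blast
  then have "bounded (f -` std_cube)"
    using assms unfolding bounded_iff isometric_embedding_def by (metis vimage_eq)
  moreover have "closed (f -` std_cube)"
    using assms compact_imp_closed[OF compact_std_cube]
    by (intro closed_vimage) (auto simp: isometric_embedding_def linear_continuous_on linear_conv_bounded_linear)
  ultimately show "compact (f -` (std_cube \<inter> range f))" unfolding eq by (simp add: compact_eq_bounded_closed)
qed

text \<open>Takes \<open>\<alpha>\<close> to be a quarter of the area: two slabs give the
  determinant bound, three give the hexagon bound.\<close>

lemma measure_section_le: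
  fixes f :: "real^2 \<Rightarrow> real^'n"
  assumes f: "isometric_embedding f"
  shows "measure lebesgue (f -` (std_cube \<inter> range f)) \<le> 4 * sqrt (turan_number CARD('n))"
proof -
  let ?K = "f -` (std_cube \<inter> range f)"
  have slab: "\<bar>row_vec f i \<bullet> x\<bar> \<le> 1" if "x \<in> ?K" for x i
    using that f by (simp add: std_cube_def row_vec_inner isometric_embedding_def)
  note K = lmeasurable_section[OF f]
  have "measure lebesgue ?K / 4 \<le> sqrt (turan_number CARD('n))"
  proof (rule isometric_embedding_scale_bound[OF f])
    show "measure lebesgue ?K / 4 * \<bar>det2 (row_vec f i) (row_vec f j)\<bar> \<le> 1" for i j
      using measure_slab_parallelogram_le[OF K, of "row_vec f i" "row_vec f j"] slab
      by (auto simp: mult.commute)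
    show "(p + q - r)\<^sup>2 \<le> 4 * p * q * (1 - measure lebesgue ?K / 4 * r)"
      if "r = \<bar>det2 (row_vec f i) (row_vec f j)\<bar>" "p = \<bar>det2 (row_vec f j) (row_vec f k)\<bar>"
        "q = \<bar>det2 (row_vec f i) (row_vec f k)\<bar>" "0 < r" "0 < p" "0 < q" "p \<le> r" "q \<le> r" "r \<le> p + q"
      for i j k p q r
    proof -
      have "r * measure lebesgue ?K \<le> 4 - (p + q - r)\<^sup>2 / (p * q)"
        unfolding that(1-3)
        using measure_slab_hexagon_le[OF K, of "row_vec f i" "row_vec f j" "row_vec f k"] slab that
        by auto
      then have "(p + q - r)\<^sup>2 / (p * q) \<le> 4 - r * measure lebesgue ?K" by simp
      then have "(p + q - r)\<^sup>2 \<le> (4 - r * measure lebesgue ?K) * (p * q)"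
        using \<open>0 < p\<close> \<open>0 < q\<close> by (simp only: pos_divide_le_eq mult_pos_pos)
      then show ?thesis by (simp add: algebra_simps)
    qed
  qed simp
  then show ?thesis by simp
qed

section \<open>Area of projections of the cross-polytope\<close>

lemma convex_std_cross: "convex (std_cross :: (real^'n) set)"
proof (rule convexI)
  fix x y :: "real^'n" and u v :: real
  assume *: "x \<in> std_cross" "y \<in> std_cross" "0 \<le> u" "0 \<le> v" "u + v = 1"
  have "(\<Sum>i\<in>UNIV. \<bar>(u *\<^sub>R x + v *\<^sub>R y) $ i\<bar>) \<le> (\<Sum>i\<in>UNIV. u * \<bar>x $ i\<bar> + v * \<bar>y $ i\<bar>)"
    using * by (intro sum_mono) (simp add: order_trans[OF abs_triangle_ineq] abs_mult)
  also have "\<dots> = u * (\<Sum>i\<in>UNIV. \<bar>x $ i\<bar>) + v * (\<Sum>i\<in>UNIV. \<bar>y $ i\<bar>)"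
    by (simp add: sum.distrib sum_distrib_left)
  also have "\<dots> \<le> u * 1 + v * 1"
    using * by (intro add_mono mult_left_mono) (auto simp: std_cross_def)
  finally show "u *\<^sub>R x + v *\<^sub>R y \<in> std_cross" using * by (simp add: std_cross_def)
qed

lemma bounded_std_cross: "bounded (std_cross :: (real^'n) set)"
  unfolding bounded_iff std_cross_def using norm_le_l1_cart order_trans by blast

text \<open>In the coordinates given by \<open>f\<close>, orthogonal projection onto
  \<open>range f\<close> is the adjoint of \<open>f\<close>.\<close>

lemma vimage_proj_onto:
  assumes "isometric_embedding f"
  shows "f -` proj_onto (range f) S = (\<lambda>c. \<Sum>i\<in>UNIV. c $ i *\<^sub>R row_vec f i) ` S"
proof -
  have lin: "linear f" using assms by (simp add: isometric_embedding_def)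
  have "(\<forall>w. (c - f z) \<bullet> f w = 0) \<longleftrightarrow> z = (\<Sum>i\<in>UNIV. c $ i *\<^sub>R row_vec f i)" for c z
    unfolding vector_eq_rdot[symmetric, of z]
    by (auto simp: inner_diff_left isometric_embedding_inner[OF assms] sum_row_vec[OF lin])
  then show ?thesis by (auto simp: proj_onto_def)
qed

lemma linear_row_vec_comb: "linear (\<lambda>c. \<Sum>i\<in>UNIV. c $ i *\<^sub>R row_vec f i)"
  by (intro linearI) (simp_all add: scaleR_add_left sum.distrib scaleR_sum_right)

lemma
  assumes "isometric_embedding f"
  shows convex_vimage_proj_cross: "convex (f -` proj_onto (range f) std_cross)"
    and lmeasurable_vimage_proj_cross: "f -` proj_onto (range f) std_cross \<in> lmeasurable"
proof -
  show c: "convex (f -` proj_onto (range f) std_cross)"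
    unfolding vimage_proj_onto[OF assms]
    by (intro convex_linear_image linear_row_vec_comb convex_std_cross)
  have "bounded (f -` proj_onto (range f) std_cross)"
    unfolding vimage_proj_onto[OF assms]
    by (intro bounded_linear_image bounded_std_cross linear_row_vec_comb[unfolded linear_conv_bounded_linear])
  with c show "f -` proj_onto (range f) std_cross \<in> lmeasurable" by (rule measurable_convex)
qed

lemma row_vec_in_proj_cross:
  assumes "isometric_embedding f"
  shows "row_vec f i \<in> f -` proj_onto (range f) std_cross \<and> - row_vec f i \<in> f -` proj_onto (range f) std_cross"
proof -
  have "s *\<^sub>R row_vec f i \<in> f -` proj_onto (range f) std_cross" if "\<bar>s\<bar> = 1" for s
  proof -
    have "axis i s \<in> std_cross"
      using that by (simp add: std_cross_def axis_def if_distrib[of abs] cong: if_cong)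
    moreover have "(\<Sum>j\<in>UNIV. axis i s $ j *\<^sub>R row_vec f j) = s *\<^sub>R row_vec f i"
      by (simp add: axis_def if_distrib[of "\<lambda>c. c *\<^sub>R _"] cong: if_cong)
    ultimately show ?thesis unfolding vimage_proj_onto[OF assms] by force
  qed
  from this[of 1] this[of "-1"] show ?thesis by simp
qed

text \<open>Takes \<open>\<alpha> = 2 / \<beta>\<close> with \<open>\<beta>\<close> the area of the
  projection, which contains the hexagons built on three frame vectors.\<close>

lemma measure_projection_ge:
  fixes f :: "real^2 \<Rightarrow> real^'n"
  assumes f: "isometric_embedding f"
  shows "2 / sqrt (turan_number CARD('n)) \<le> measure lebesgue (f -` proj_onto (range f) std_cross)"
proof -
  let ?P = "f -` proj_onto (range f) std_cross"
  define \<beta> where "\<beta> = measure lebesgue ?P"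
  have hexagon: "\<bar>det2 (row_vec f i) (row_vec f j)\<bar> + \<bar>det2 (row_vec f j) (row_vec f k)\<bar>
      + \<bar>det2 (row_vec f i) (row_vec f k)\<bar> \<le> \<beta>"
    if "det2 (row_vec f i) (row_vec f j) \<noteq> 0" "\<bar>det2 (row_vec f i) (row_vec f j)\<bar>
      \<le> \<bar>det2 (row_vec f j) (row_vec f k)\<bar> + \<bar>det2 (row_vec f i) (row_vec f k)\<bar>" for i j k
    unfolding \<beta>_def
    using convex_vimage_proj_cross[OF f] lmeasurable_vimage_proj_cross[OF f] row_vec_in_proj_cross[OF f] that
    by (intro measure_convex_ge_hexagon) blast+
  have "\<exists>i j. det2 (row_vec f i) (row_vec f j) \<noteq> 0"
  proof (rule ccontr)
    assume "\<not> ?thesis"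
    then show False using sum_det2_row_vec_sq[OF f] by simp
  qed
  then obtain i0 j0 where nz: "det2 (row_vec f i0) (row_vec f j0) \<noteq> 0" by blast
  \<comment> \<open>With \<open>k = i\<close> the hexagon degenerates to a parallelogram of area
    twice the determinant.\<close>
  then have "0 < \<beta>"
    using hexagon[of i0 j0 i0] abs_det2_commute[of "row_vec f i0" "row_vec f j0"] by simp
  have "2 / \<beta> \<le> sqrt (turan_number CARD('n))"
  proof (rule isometric_embedding_scale_bound[OF f])
    show "2 / \<beta> * \<bar>det2 (row_vec f i) (row_vec f j)\<bar> \<le> 1" for i j
    proof (cases "det2 (row_vec f i) (row_vec f j) = 0")
      case False
      then show ?thesis
        using hexagon[of i j i] abs_det2_commute[of "row_vec f i" "row_vec f j"] \<open>0 < \<beta>\<close>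
        by (simp add: field_simps)
    qed simp
    show "(p + q - r)\<^sup>2 \<le> 4 * p * q * (1 - 2 / \<beta> * r)"
      if "r = \<bar>det2 (row_vec f i) (row_vec f j)\<bar>" "p = \<bar>det2 (row_vec f j) (row_vec f k)\<bar>"
        "q = \<bar>det2 (row_vec f i) (row_vec f k)\<bar>" "0 < r" "0 < p" "0 < q" "p \<le> r" "q \<le> r" "r \<le> p + q"
      for i j k p q r
    proof -
      \<comment> \<open>The hexagon bound \<open>r + p + q \<le> \<beta>\<close> is stronger than needed, because \<open>\<bar>p - q\<bar> \<le> r\<close>.\<close>
      have "r + p + q \<le> \<beta>" using hexagon[of i j k] that by auto
      then have "2 / \<beta> * r \<le> 2 / (r + p + q) * r"
        using \<open>0 < \<beta>\<close> \<open>0 < r\<close> \<open>0 < p\<close> \<open>0 < q\<close> by (intro mult_right_mono divide_left_mono mult_pos_pos) simp_all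
      also have "\<dots> = 1 - (p + q - r) / (r + p + q)"
        using \<open>0 < r\<close> \<open>0 < p\<close> \<open>0 < q\<close> by (simp add: field_simps)
      finally have "4 * p * q * ((p + q - r) / (r + p + q)) \<le> 4 * p * q * (1 - 2 / \<beta> * r)"
        using that by (intro mult_left_mono) auto
      moreover have "(p + q - r)\<^sup>2 \<le> 4 * p * q * ((p + q - r) / (r + p + q))"
      proof -
        have "\<bar>p - q\<bar> \<le> r" using that by linarith
        then have "(p - q)\<^sup>2 \<le> r\<^sup>2" using that by (metis abs_le_square_iff abs_of_pos)
        then have "(p + q - r) * (r + p + q) \<le> 4 * p * q" by (simp add: power2_eq_square algebra_simps)
        then have "(p + q - r) * ((p + q - r) * (r + p + q)) / (r + p + q)
            \<le> (p + q - r) * (4 * p * q) / (r + p + q)"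
          using \<open>0 < r\<close> \<open>0 < p\<close> \<open>0 < q\<close> \<open>r \<le> p + q\<close>
          by (intro divide_right_mono mult_left_mono) simp_all
        moreover have "x * (x * s) / s = x\<^sup>2" if "0 < s" for x s :: real
          using that by (simp add: power2_eq_square)
        moreover have "0 < r + p + q" using \<open>0 < r\<close> \<open>0 < p\<close> \<open>0 < q\<close> by simp
        ultimately show ?thesis by (simp only: times_divide_eq_right mult.commute)
      qed
      ultimately show ?thesis by linarith
    qed
  qed (use \<open>0 < \<beta>\<close> in simp)
  moreover from this have "0 < sqrt (turan_number CARD('n))"
    using \<open>0 < \<beta>\<close> by (smt (verit) divide_pos_pos)
  ultimately show ?thesis using \<open>0 < \<beta>\<close> unfolding \<beta>_def[symmetric] by (simp add: field_simps)
qed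

section \<open>Independence of the area from the chosen isometry\<close>

lemma vol2_isometric_embedding:
  fixes H :: "(real^'n) set"
  assumes "subspace H" "dim H = 2"
  obtains f where "isometric_embedding f" "range f = H" "\<And>A. vol2 H A = measure lebesgue (f -` A)"
proof -
  have "dim H = dim (UNIV :: (real^2) set)" using assms by simp
  then obtain g :: "real^2 \<Rightarrow> real^'n" where "linear g" "range g = H" "\<And>x. norm (g x) = norm x"
    using isometries_subspaces[OF subspace_UNIV assms(1)] by (metis UNIV_I)
  then have "\<exists>g :: real^2 \<Rightarrow> real^'n. linear g \<and> (\<forall>x. norm (g x) = norm x) \<and> range g = H" by blast
  from someI_ex[OF this] show ?thesis
    by (intro that[of "SOME g. linear g \<and> (\<forall>x. norm (g x) = norm x) \<and> range g = H"])
      (auto simp: isometric_embedding_def vol2_def)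
qed

lemma subspace_range_isometric_embedding:
  assumes "isometric_embedding f"
  shows "subspace (range f)" "dim (range f) = 2"
proof -
  have lin: "linear f" using assms by (simp add: isometric_embedding_def)
  then show "subspace (range f)" by (simp add: linear_subspace_image)
  have "inj f" using assms lin by (simp add: isometric_embedding_def linear_injective_0 flip: norm_eq_zero[of "f _"])
  then show "dim (range f) = 2" using dim_image_eq[OF lin, of UNIV] by simp
qed

text \<open>\<open>vol2\<close> picks some isometry \<open>g\<close> onto the plane, possibly other
  than \<open>f\<close>. The transition map \<open>adjoint g \<circ> f\<close> is orthogonal and
  thus preserves area.\<close>

lemma vol2_range:
  assumes f: "isometric_embedding f" and A: "f -` A \<in> lmeasurable"
  shows "vol2 (range f) A = measure lebesgue (f -` A)"
proof -
  obtain g where g: "isometric_embedding g" "range g = range f"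
    "\<And>A. vol2 (range f) A = measure lebesgue (g -` A)"
    using vol2_isometric_embedding[OF subspace_range_isometric_embedding[OF f]] by metis
  have lin: "linear f" "linear g" using f g by (auto simp: isometric_embedding_def)
  define h where "h = adjoint g \<circ> f"
  have left: "adjoint g (g z) = z" for z
  proof -
    have "adjoint g (g z) \<bullet> w = z \<bullet> w" for w
      by (metis adjoint_works inner_commute isometric_embedding_inner g(1) lin(2))
    then show ?thesis using vector_eq_rdot by blast
  qed
  have gh: "g (h x) = f x" for x
  proof -
    obtain z where "f x = g z" using g(2) by (metis rangeE rangeI)
    then show ?thesis by (simp add: h_def left)
  qed
  then have "norm (h x) = norm x" for x using f g(1) by (metis isometric_embedding_def)
  moreover have "linear h" unfolding h_def by (intro linear_compose adjoint_linear lin)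
  ultimately have h: "orthogonal_transformation h" by (simp add: orthogonal_transformation)
  have "g -` A = h ` (f -` A)"
  proof (intro equalityI subsetI)
    fix x assume "x \<in> g -` A"
    moreover obtain y where "x = h y" using orthogonal_transformation_surj[OF h] by (metis surjD)
    ultimately show "x \<in> h ` (f -` A)" by (auto simp: gh)
  qed (auto simp: gh)
  then show ?thesis using g(3) measure_orthogonal_image[OF h A] by simp
qed

section \<open>The extremal planes, with equal coordinates inside each of two blocks\<close>

definition block_embedding :: "'n set \<Rightarrow> real^2 \<Rightarrow> real^'n" where
  "block_embedding I x = (\<chi> i. if i \<in> I then x $ 1 / sqrt (card I) else x $ 2 / sqrt (card (- I)))"

lemma card_blocks_pos:
  assumes "I \<noteq> {}" "I \<noteq> (UNIV :: 'n::finite set)"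
  shows "0 < card I" "0 < card (- I)" "- I \<noteq> {}"
  using assms by (auto simp: card_gt_0_iff)

lemma isometric_block_embedding:
  assumes I: "I \<noteq> {}" "I \<noteq> (UNIV :: 'n::finite set)"
  shows "isometric_embedding (block_embedding I)"
proof -
  have pos: "0 < card I" "0 < card (- I)" "I \<noteq> {}" "- I \<noteq> {}" using card_blocks_pos[OF I] I(1) by blast+
  have lin: "linear (block_embedding I)"
    by (intro linearI) (auto simp: block_embedding_def vec_eq_iff add_divide_distrib)
  have "block_embedding I x \<bullet> block_embedding I x = x \<bullet> x" for x
  proof -
    have "block_embedding I x \<bullet> block_embedding I x
        = (\<Sum>i\<in>UNIV. if i \<in> I then (x $ 1)\<^sup>2 / card I else (x $ 2)\<^sup>2 / card (- I))"
      by (auto simp: inner_vec_def block_embedding_def power2_eq_square intro!: sum.cong)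
    also have "\<dots> = (x $ 1)\<^sup>2 + (x $ 2)\<^sup>2" using pos by (simp add: sum.If_cases)
    finally show ?thesis by (simp add: inner_vec_def sum_2 power2_eq_square)
  qed
  then show ?thesis using lin by (simp add: isometric_embedding_def norm_eq_sqrt_inner)
qed

text \<open>Only two different slabs remain on this plane, so the section is a rectangle with
  half-sides \<open>sqrt (card I)\<close> and \<open>sqrt (card (- I))\<close>.\<close>

lemma section_block_embedding:
  assumes I: "I \<noteq> {}" "I \<noteq> (UNIV :: 'n::finite set)"
  defines "f \<equiv> block_embedding I"
  shows "affine_copy (std_cube :: (real^2) set) (std_cube \<inter> range f)"
    and "measure lebesgue (f -` (std_cube \<inter> range f)) = 4 * sqrt (card I * card (- I))"
proof -
  have pos: "0 < card I" "0 < card (- I)" "I \<noteq> {}" "- I \<noteq> {}" using card_blocks_pos[OF I] I(1) by blast+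
  obtain i j where ij: "i \<in> I" "j \<notin> I" using I by auto
  let ?u = "vector [sqrt (card I), 0] :: real^2" and ?w = "vector [0, sqrt (card (- I))] :: real^2"
  let ?L = "\<lambda>y :: real^2. y $ 1 *\<^sub>R ?u + y $ 2 *\<^sub>R ?w"
  let ?g = "\<lambda>x :: real^2. (\<chi> i. if i \<in> I then x $ 1 else x $ 2) :: real^'n"
  have fL: "f (?L y) = ?g y" for y
    using pos by (auto simp: f_def block_embedding_def vec_eq_iff)
  have L: "\<exists>y. x = ?L y" for x
    using pos by (intro exI[of _ "vector [x $ 1 / sqrt (card I), x $ 2 / sqrt (card (- I))]"])
      (simp add: vec_eq_iff forall_2)
  have g_cube: "?g y \<in> std_cube \<longleftrightarrow> y \<in> std_cube" for y
    using ij by (auto simp: std_cube_def forall_2)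
  have "linear ?g" by (intro linearI) (auto simp: vec_eq_iff)
  moreover have "inj ?g" using ij by (intro injI) (simp add: vec_eq_iff forall_2, metis)
  moreover have "std_cube \<inter> range f = (\<lambda>x. 0 + ?g x) ` std_cube"
  proof (intro equalityI subsetI)
    fix z assume "z \<in> std_cube \<inter> range f"
    then obtain y where "z = ?g y" using L fL by (metis IntD2 rangeE)
    with \<open>z \<in> std_cube \<inter> range f\<close> show "z \<in> (\<lambda>x. 0 + ?g x) ` std_cube" using g_cube by auto
  next
    fix z assume "z \<in> (\<lambda>x. 0 + ?g x) ` std_cube"
    then obtain y where "y \<in> std_cube" "z = ?g y" by auto
    then show "z \<in> std_cube \<inter> range f" using g_cube fL by (metis IntI rangeI)
  qed
  ultimately show "affine_copy (std_cube :: (real^2) set) (std_cube \<inter> range f)"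
    unfolding affine_copy_def by blast
  have "f -` (std_cube \<inter> range f) = ?L ` std_cube"
  proof (intro equalityI subsetI)
    fix x assume x: "x \<in> f -` (std_cube \<inter> range f)"
    obtain y where "x = ?L y" using L by blast
    with x fL g_cube show "x \<in> ?L ` std_cube" by auto
  qed (use fL g_cube in auto)
  moreover have "\<bar>det2 ?u ?w\<bar> = sqrt (card I * card (- I))"
    by (simp add: det2_def real_sqrt_mult)
  ultimately show "measure lebesgue (f -` (std_cube \<inter> range f)) = 4 * sqrt (card I * card (- I))"
    using measure_image_frame[OF measure_std_cube_2(1), of ?u ?w] measure_std_cube_2(2) by simp
qed

text \<open>The frame has only two different members, \<open>?u\<close> and \<open>?w\<close>, so
  the projection depends on the block sums only and is a rhombus with these vectors and their
  negatives as vertices.\<close>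

lemma projection_block_embedding:
  assumes I: "I \<noteq> {}" "I \<noteq> (UNIV :: 'n::finite set)"
  defines "f \<equiv> block_embedding I"
  shows "affine_copy (std_cross :: (real^2) set) (proj_onto (range f) std_cross)"
    and "measure lebesgue (f -` proj_onto (range f) std_cross) = 2 / sqrt (card I * card (- I))"
proof -
  have f: "isometric_embedding f" unfolding f_def using I by (rule isometric_block_embedding)
  then have lin: "linear f" by (simp add: isometric_embedding_def)
  have pos: "0 < card I" "0 < card (- I)" "I \<noteq> {}" "- I \<noteq> {}" using card_blocks_pos[OF I] I(1) by blast+
  obtain i j where ij: "i \<in> I" "j \<notin> I" using I by auto
  let ?u = "vector [1 / sqrt (card I), 0] :: real^2" and ?w = "vector [0, 1 / sqrt (card (- I))] :: real^2"
  let ?L = "\<lambda>y :: real^2. y $ 1 *\<^sub>R ?u + y $ 2 *\<^sub>R ?w"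
  have row: "row_vec f i = (if i \<in> I then ?u else ?w)" for i
    by (simp add: row_vec_def f_def block_embedding_def axis_def)
  have comb: "(\<Sum>i\<in>UNIV. c $ i *\<^sub>R row_vec f i) = ?L (vector [\<Sum>i\<in>I. c $ i, \<Sum>i\<in>- I. c $ i])" for c
    unfolding row by (simp add: if_distrib[of "\<lambda>x. _ *\<^sub>R x"] sum.If_cases scaleR_sum_left)
  have eq: "f -` proj_onto (range f) std_cross = ?L ` std_cross"
    unfolding vimage_proj_onto[OF f] comb
  proof (intro equalityI subsetI)
    fix x assume "x \<in> (\<lambda>c. ?L (vector [\<Sum>i\<in>I. c $ i, \<Sum>i\<in>- I. c $ i])) ` std_cross"
    then obtain c :: "real^'n" where c: "c \<in> std_cross" "x = ?L (vector [\<Sum>i\<in>I. c $ i, \<Sum>i\<in>- I. c $ i])"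
      by blast
    have "\<bar>\<Sum>i\<in>I. c $ i\<bar> + \<bar>\<Sum>i\<in>- I. c $ i\<bar> \<le> (\<Sum>i\<in>I. \<bar>c $ i\<bar>) + (\<Sum>i\<in>- I. \<bar>c $ i\<bar>)"
      by (intro add_mono sum_abs)
    also have "\<dots> = (\<Sum>i\<in>UNIV. \<bar>c $ i\<bar>)" by (subst sum.union_disjoint[symmetric]) auto
    finally have "vector [\<Sum>i\<in>I. c $ i, \<Sum>i\<in>- I. c $ i] \<in> (std_cross :: (real^2) set)"
      using c(1) by (simp add: std_cross_def sum_2)
    with c(2) show "x \<in> ?L ` std_cross" by blast
  next
    fix x assume "x \<in> ?L ` std_cross"
    then obtain y where y: "y \<in> std_cross" "x = ?L y" by blast
    \<comment> \<open>All of \<open>y $ 1\<close> is put on one index in \<open>I\<close>, all of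
      \<open>y $ 2\<close> on one index outside; the l1-norm does not grow.\<close>
    let ?c = "axis i (y $ 1) + axis j (y $ 2) :: real^'n"
    have "(\<Sum>k\<in>UNIV. \<bar>?c $ k\<bar>) \<le> (\<Sum>k\<in>UNIV. \<bar>axis i (y $ 1) $ k\<bar> + \<bar>axis j (y $ 2) $ k\<bar>)"
      by (intro sum_mono) simp
    also have "\<dots> = \<bar>y $ 1\<bar> + \<bar>y $ 2\<bar>"
      by (simp add: sum.distrib axis_def if_distrib[of abs] cong: if_cong)
    finally have "?c \<in> std_cross" using y(1) by (simp add: std_cross_def sum_2)
    moreover have "vector [\<Sum>k\<in>I. ?c $ k, \<Sum>k\<in>- I. ?c $ k] = y"
      using ij by (simp add: vec_eq_iff forall_2 sum.distrib axis_def)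
    ultimately show "x \<in> (\<lambda>c. ?L (vector [\<Sum>i\<in>I. c $ i, \<Sum>i\<in>- I. c $ i])) ` std_cross"
      using y(2) by (metis (no_types, lifting) imageI)
  qed
  have "linear ?L" by (intro linearI) (auto simp: algebra_simps)
  then have "linear (f \<circ> ?L)" using lin by (rule linear_compose)
  moreover have "inj f" using f lin by (simp add: isometric_embedding_def linear_injective_0 flip: norm_eq_zero[of "f _"])
  moreover have "inj ?L" using pos by (intro injI) (simp add: vec_eq_iff forall_2)
  moreover have "proj_onto (range f) std_cross = f ` (f -` proj_onto (range f) std_cross)"
    by (auto simp: proj_onto_def)
  then have "proj_onto (range f) std_cross = (\<lambda>x. 0 + (f \<circ> ?L) x) ` std_cross"
    unfolding eq by (simp add: image_image)
  ultimately show "affine_copy (std_cross :: (real^2) set) (proj_onto (range f) std_cross)"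
    unfolding affine_copy_def by (intro exI[of _ 0] exI[of _ "f \<circ> ?L"] conjI inj_compose)
  have "\<bar>det2 ?u ?w\<bar> = 1 / sqrt (card I * card (- I))"
    by (simp add: det2_def real_sqrt_mult)
  then show "measure lebesgue (f -` proj_onto (range f) std_cross) = 2 / sqrt (card I * card (- I))"
    unfolding eq measure_image_frame[OF measure_std_cross_2(1)] measure_std_cross_2(2) by simp
qed

theorem theorem2:
  assumes "CARD('n::finite) \<ge> 2"
  shows
   "(\<exists>H0 :: (real^'n) set. subspace H0 \<and> dim H0 = 2 \<and>
        affine_copy (std_cube :: (real^2) set) (std_cube \<inter> H0) \<and>
        (\<forall>H :: (real^'n) set. subspace H \<and> dim H = 2 \<longrightarrow>
            vol2 H (std_cube \<inter> H) \<le> vol2 H0 (std_cube \<inter> H0)))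
  \<and> (\<exists>H0 :: (real^'n) set. subspace H0 \<and> dim H0 = 2 \<and>
        affine_copy (std_cross :: (real^2) set) (proj_onto H0 std_cross) \<and>
        (\<forall>H :: (real^'n) set. subspace H \<and> dim H = 2 \<longrightarrow>
            vol2 H0 (proj_onto H0 std_cross) \<le> vol2 H (proj_onto H std_cross)))"
proof -
  \<comment> \<open>One balanced split serves both extremal problems; with at least two coordinates
    both blocks are nonempty.\<close>
  have "CARD('n) div 2 \<le> card (UNIV :: 'n set)" by simp
  then obtain I :: "'n set" where I: "card I = CARD('n) div 2"
    by (rule obtain_subset_with_card_n)
  then have cI: "card (- I) = CARD('n) - CARD('n) div 2"
    by (simp add: Compl_eq_Diff_UNIV card_Diff_subset)
  have ne: "I \<noteq> {}" "I \<noteq> UNIV" using I assms by auto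
  let ?f = "block_embedding I"
  have f: "isometric_embedding ?f" using ne by (rule isometric_block_embedding)
  have m: "real (card I) * real (card (- I)) = real (turan_number CARD('n))"
    by (simp add: turan_number_def I cI)
  show ?thesis
  proof (intro conjI exI[of _ "range ?f"] allI impI; (elim conjE)?)
    fix H :: "(real^'n) set" assume "subspace H" "dim H = 2"
    then obtain g where g: "isometric_embedding g" "range g = H" "\<And>A. vol2 H A = measure lebesgue (g -` A)"
      using vol2_isometric_embedding by metis
    show "vol2 H (std_cube \<inter> H) \<le> vol2 (range ?f) (std_cube \<inter> range ?f)"
      using measure_section_le[OF g(1)] section_block_embedding(2)[OF ne]
      by (simp add: g m vol2_range[OF f lmeasurable_section[OF f]])
    show "vol2 (range ?f) (proj_onto (range ?f) std_cross) \<le> vol2 H (proj_onto H std_cross)"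
      using measure_projection_ge[OF g(1)] projection_block_embedding(2)[OF ne]
      by (simp add: g m vol2_range[OF f lmeasurable_vimage_proj_cross[OF f]])
  qed (use subspace_range_isometric_embedding[OF f] section_block_embedding(1)[OF ne]
      projection_block_embedding(1)[OF ne] in auto)
qed

end
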